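(* There exists an absolute constant $C>0$ such that the following holds. Let $\mu$ be a probability measure supported on $\mathbb{N}=\{0,1,2,\dots\}$, and let $T$ be a Galton-Watson tree with offspring distribution $\mu$. Then for all $x\ge 1$, $$\mathbf{P}\left\{\mathrm{ht}(T) > C x\,\frac{\mathrm{wid}(T)}{1-\mu(1)}\right\}\le e^{-x}\quad\text{and}\quad \mathbf{P}\left\{\mathrm{ht}(T) > C x\left(\frac{|T|}{1-\mu(1)}\right)^{1/2}\right\}\le e^{-x^2}.$$
   Context: A Galton-Watson tree with offspring distribution $\mu$ is the random rooted tree in which each node has a random, $\mu$-distributed number of children, independently for distinct nodes. For a rooted tree $T$, $T_n$ is the set of nodes at distance $n$ from the root, $\mathrm{wid}(T)=\sup_{n\ge 0}|T_n|$ is the width, $\mathrm{ht}(T)=\sup\{n\ge 0:|T_n|\neq 0\}$ is the height, and $|T|$ is the number of nodes; each of these may be infinite. We write $\mu(i)$ for $\mu(\{i\})$. "Absolute constant" means that $C$ does not depend on $\mu$ or $x$. *)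

theory Defs
  imports "HOL-Probability.Probability"
begin

section \<open>Rooted trees\<close>

text \<open>
  Trees are coded in the Ulam--Harris way: a node is the finite word of child indices read along
  the path from the root, so the root is \<open>[]\<close>, the children of \<open>u\<close> are the words \<open>u @ [i]\<close>, and
  the distance of \<open>u\<close> from the root is \<open>length u\<close>.
\<close>

type_synonym node = "nat list"

definition ecard :: "'a set \<Rightarrow> enat" where
  "ecard A = (if finite A then enat (card A) else \<infinity>)"

definition level :: "node set \<Rightarrow> nat \<Rightarrow> node set" where
  "level T n = {u \<in> T. length u = n}"

definition wid :: "node set \<Rightarrow> enat" where
  "wid T = (SUP n. ecard (level T n))"

definition ht :: "node set \<Rightarrow> enat" where
  "ht T = Sup {enat n | n. ecard (level T n) \<noteq> 0}"

section \<open>Galton--Watson trees\<close>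

text \<open>
  The tree in which each node \<open>u\<close> has \<open>c u\<close> children, namely \<open>u @ [0], \<dots>, u @ [c u - 1]\<close>.  The
  values of \<open>c\<close> at words that are not nodes of the tree play no role.
\<close>

inductive_set tree_of :: "(node \<Rightarrow> nat) \<Rightarrow> node set" for c :: "node \<Rightarrow> nat" where
  root: "[] \<in> tree_of c"
| child: "u \<in> tree_of c \<Longrightarrow> i < c u \<Longrightarrow> u @ [i] \<in> tree_of c"

text \<open>
  Independent \<open>\<mu>\<close>-distributed offspring numbers, one for each word.  A Galton--Watson tree with
  offspring distribution \<open>\<mu>\<close> is the random tree \<open>tree_of c\<close>, where \<open>c\<close> has this law.
\<close>

definition gw_offspring :: "nat pmf \<Rightarrow> (node \<Rightarrow> nat) measure" where
  "gw_offspring \<mu> = (\<Pi>\<^sub>M u\<in>UNIV. measure_pmf \<mu>)"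

section \<open>Square roots in the extended half-line\<close>

text \<open>
  The bounds are compared in \<^typ>\<open>ennreal\<close>, where \<open>a / 0 = \<infinity>\<close> for \<open>a > 0\<close>: they are infinite if
  \<open>\<mu>(1) = 1\<close>, which is the case where the tree is an infinite path.
\<close>

definition ennreal_sqrt :: "ennreal \<Rightarrow> ennreal" where
  "ennreal_sqrt a = (if a = \<infinity> then \<infinity> else ennreal (sqrt (enn2real a)))"

section \<open>Measurability\<close>

text \<open>
  \<^const>\<open>measure\<close> is 0 on non-measurable sets; the following facts show that the height, the
  width and the number of nodes of a Galton--Watson tree are genuine random variables.
\<close>

lemma prob_space_gw_offspring: "prob_space (gw_offspring \<mu>)"
  unfolding gw_offspring_def by (intro prob_space_PiM prob_space_measure_pmf)

lemma space_gw_offspring [simp]: "space (gw_offspring \<mu>) = UNIV"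
  by (simp add: gw_offspring_def space_PiM)

lemma snoc_in_tree_of_iff: "u @ [i] \<in> tree_of c \<longleftrightarrow> u \<in> tree_of c \<and> i < c u"
  by (auto intro: tree_of.child elim: tree_of.cases)

lemma measurable_offspring_number [measurable]:
  "(\<lambda>c. c u) \<in> measurable (gw_offspring \<mu>) (count_space UNIV)"
proof -
  have "(\<lambda>c. c u) \<in> measurable (gw_offspring \<mu>) (measure_pmf \<mu>)"
    unfolding gw_offspring_def by (rule measurable_component_singleton) simp
  then show ?thesis by simp
qed

lemma measurable_in_tree_of [measurable]: "Measurable.pred (gw_offspring \<mu>) (\<lambda>c. u \<in> tree_of c)"
proof (induction u rule: rev_induct)
  case Nil
  show ?case by (simp add: tree_of.root)
next
  case (snoc i u)
  note snoc [measurable]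
  show ?case unfolding snoc_in_tree_of_iff by measurable
qed

lemma ennreal_of_enat_ecard: "ennreal_of_enat (ecard A) = emeasure (count_space UNIV) A"
  by (simp add: ecard_def emeasure_count_space)

lemma measurable_ecard_Collect:
  fixes P :: "'a \<Rightarrow> 'b :: countable \<Rightarrow> bool"
  assumes [measurable]: "\<And>u. Measurable.pred M (\<lambda>c. P c u)"
  shows "(\<lambda>c. ecard {u. P c u}) \<in> measurable M (count_space UNIV)"
proof (rule measurable_count_space_eq2_countable[THEN iffD2], intro conjI ballI)
  interpret sigma_finite_measure "count_space (UNIV :: 'b set)"
    by (rule sigma_finite_measure_count_space_countable) simp
  have [measurable]: "(\<lambda>x. indicator {u. P (fst x) u} (snd x) :: ennreal)
      \<in> borel_measurable (M \<Otimes>\<^sub>M count_space UNIV)"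
    unfolding indicator_def mem_Collect_eq
    by (rule measurable_compose_countable'[where I = UNIV and g = snd
          and f = "\<lambda>u x. of_bool (P (fst x) u)"]) auto
  have "(\<lambda>c. \<integral>\<^sup>+u. indicator {u. P c u} u \<partial>count_space UNIV) \<in> borel_measurable M"
    by (rule borel_measurable_nn_integral) (simp add: case_prod_beta')
  then have *: "(\<lambda>c. ennreal_of_enat (ecard {u. P c u})) \<in> borel_measurable M"
    by (simp add: ennreal_of_enat_ecard nn_integral_indicator)
  show "(\<lambda>c. ecard {u. P c u}) -` {k} \<inter> space M \<in> sets M" if "k \<in> UNIV" for k
  proof -
    have "(\<lambda>c. ecard {u. P c u}) -` {k} \<inter> space M
      = (\<lambda>c. ennreal_of_enat (ecard {u. P c u})) -` {ennreal_of_enat k} \<inter> space M"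
      by auto
    also have "\<dots> \<in> sets M" by (rule measurable_sets[OF *]) simp
    finally show ?thesis .
  qed
qed auto

lemma measurable_ecard_level [measurable]:
  "(\<lambda>c. ecard (level (tree_of c) n)) \<in> measurable (gw_offspring \<mu>) (count_space UNIV)"
  unfolding level_def by (rule measurable_ecard_Collect) measurable

lemma measurable_ecard_tree_of [measurable]:
  "(\<lambda>c. ecard (tree_of c)) \<in> measurable (gw_offspring \<mu>) (count_space UNIV)"
  using measurable_ecard_Collect[where P = "\<lambda>c u. u \<in> tree_of c" and M = "gw_offspring \<mu>"]
  by simp

lemma measurable_wid [measurable]:
  "(\<lambda>c. wid (tree_of c)) \<in> measurable (gw_offspring \<mu>) (count_space UNIV)"
  unfolding wid_def by measurable

lemma ht_eq_SUP: "ht T = (SUP n. if ecard (level T n) \<noteq> 0 then enat n else 0)"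
  unfolding ht_def
  by (intro antisym Sup_least SUP_least) (auto intro!: Sup_upper SUP_upper2)

lemma measurable_ht [measurable]:
  "(\<lambda>c. ht (tree_of c)) \<in> measurable (gw_offspring \<mu>) (count_space UNIV)"
  unfolding ht_eq_SUP by measurable

end

theory Submission
  imports Defs "HOL-Real_Asymp.Real_Asymp"
begin

text \<open>
  Write \<open>\<sigma> = 1 - \<mu>(1)\<close>, let \<open>Z\<^sub>n\<close> be the number of nodes at distance \<open>n\<close> from the root, \<open>f\<close> the
  generating function of \<open>\<mu>\<close> and \<open>q\<close> its smallest fixed point in \<open>[0, 1]\<close>, which is the extinction
  probability.  Everything rests on two properties of the process \<open>Z\<close>.

  First, extinction is fast once it happens at all: \<open>P(Z\<^sub>n > 0, T finite) = q - f\<^sup>n(0) \<le> 2 q / (\<sigma> n)\<close>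
  for every \<open>\<mu>\<close> (\<open>gf_iterate_0_bound\<close>).  Conditioned on extinction, the tree is a Galton--Watson tree
  with the offspring law \<open>\<mu>(i) q ^ (i - 1)\<close>, which has mean at most 1 and gives 1 the same mass as \<open>\<mu>\<close>.
  A law of mean at most 1 gives 0 at least half of the mass outside 1, so \<open>\<mu>(0) \<ge> q \<sigma> / 2\<close>, and
  \<open>f(q s) \<ge> q s + \<mu>(0) (1 - s)\<^sup>2\<close>; iterating \<open>u \<mapsto> u - (\<sigma> / 2) u\<^sup>2\<close> gives the decay \<open>1 / (\<sigma> n)\<close>.

  Second, the tree spends little time at small width.  By the first property, \<open>w\<close> individuals that are
  bound for extinction leave no descendants after \<open>m \<approx> 4 w / \<sigma>\<close> generations with probability at least
  1/2.  Along the times \<open>r, r + m, r + 2 m, \<dots>\<close>, each generation of size in \<open>[1, w]\<close> is thus the last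
  nonempty one with probability at least 1/2 given extinction, so the number of such generations has a geometric tail;
  a supermartingale makes this precise (\<open>expected_reward_le\<close>), and averaging over \<open>r < m\<close>
  gives \<open>P(T finite, #{n. 1 \<le> Z\<^sub>n \<le> w} > a) \<le> 2 (q - f\<^sup>t(0)) (3/4) ^ ((a - t) / m)\<close> for all \<open>t \<le> a\<close>
  (\<open>prob_visits_le\<close>).

  Take \<open>a = 40 x w / \<sigma>\<close> and \<open>t \<approx> a / 2\<close>.  The exponential factor is then at most \<open>exp (- x)\<close>, and the
  survival factor is at most \<open>1 / (5 w)\<close>, which makes the bounds summable over \<open>w = 2 ^ k\<close>.  Hence,
  outside an event of probability at most \<open>exp (- x)\<close>, a finite tree has at most \<open>40 x w / \<sigma>\<close>
  generations of size in \<open>[1, w]\<close>, simultaneously for all powers of two \<open>w\<close>.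

  Both bounds of the theorem follow from this deterministically.  If \<open>w\<close> is at least the width, then all
  generations up to the height have size in \<open>[1, w]\<close>.  If \<open>w \<ge> 2 |T| / ht(T)\<close>, then at most \<open>ht(T) / 2\<close>
  generations have a size above \<open>w\<close>, and the others number at least \<open>ht(T) / 2\<close>; this is excessive
  for \<open>x\<^sup>2\<close> in place of \<open>x\<close> when \<open>ht(T)\<close> is above the bound.  Finally, an infinite tree of finite width has probability 0 unless
  \<open>\<sigma> = 0\<close> (\<open>forever_small_null\<close>).
\<close>

section \<open>Generation sizes\<close>

definition gen_size :: "nat \<Rightarrow> (node \<Rightarrow> nat) \<Rightarrow> nat" where
  "gen_size n c = card (level (tree_of c) n)"

lemma level_tree_of_0: "level (tree_of c) 0 = {[]}"
  by (auto simp: level_def intro: tree_of.root)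

lemma level_tree_of_Suc:
  "level (tree_of c) (Suc n) = (\<Union>u\<in>level (tree_of c) n. (\<lambda>i. u @ [i]) ` {..<c u})"
proof (intro set_eqI iffI)
  fix v assume v: "v \<in> level (tree_of c) (Suc n)"
  then obtain u i where "v = u @ [i]"
    by (cases v rule: rev_cases) (auto simp: level_def)
  with v show "v \<in> (\<Union>u\<in>level (tree_of c) n. (\<lambda>i. u @ [i]) ` {..<c u})"
    by (auto simp: level_def snoc_in_tree_of_iff)
qed (auto simp: level_def snoc_in_tree_of_iff)

lemma finite_level_tree_of: "finite (level (tree_of c) n)"
  by (induction n) (auto simp: level_tree_of_0 level_tree_of_Suc)

lemma gen_size_0 [simp]: "gen_size 0 c = 1"
  by (simp add: gen_size_def level_tree_of_0)

lemma gen_size_Suc: "gen_size (Suc n) c = (\<Sum>u\<in>level (tree_of c) n. c u)"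
proof -
  have "gen_size (Suc n) c = (\<Sum>u\<in>level (tree_of c) n. card ((\<lambda>i. u @ [i]) ` {..<c u}))"
    unfolding gen_size_def level_tree_of_Suc
    by (rule card_UN_disjoint) (auto simp: finite_level_tree_of)
  also have "\<dots> = (\<Sum>u\<in>level (tree_of c) n. c u)"
    by (intro sum.cong refl) (simp add: card_image inj_on_def)
  finally show ?thesis .
qed

lemma gen_size_eq_0_mono: "n \<le> n' \<Longrightarrow> gen_size n c = 0 \<Longrightarrow> gen_size n' c = 0"
proof (induction n' rule: dec_induct)
  case (step k)
  then have "level (tree_of c) k = {}"
    using finite_level_tree_of by (simp add: gen_size_def)
  then show ?case by (simp add: gen_size_Suc)
qed

text \<open>
  The levels up to \<open>n\<close> are determined by the offspring numbers at distance less than \<open>n\<close>.  Below,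
  the hypothesis that a function of the offspring numbers depends only on the generations up to \<open>n\<close>
  takes the form of invariance under updates at words of length at least \<open>n\<close>.
\<close>

lemma level_tree_of_update:
  "n \<le> length u \<Longrightarrow> level (tree_of (c(u := k))) n = level (tree_of c) n"
proof (induction n)
  case (Suc n)
  then have "level (tree_of (c(u := k))) n = level (tree_of c) n"
    by (intro Suc.IH) simp
  moreover have "(c(u := k)) v = c v" if "v \<in> level (tree_of c) n" for v
    using that Suc.prems by (auto simp: level_def)
  ultimately show ?case unfolding level_tree_of_Suc by simp
qed (simp add: level_tree_of_0)

lemma gen_size_update: "n \<le> length u \<Longrightarrow> gen_size n (c(u := k)) = gen_size n c"
  by (simp add: gen_size_def level_tree_of_update)

lemma ecard_level: "ecard (level (tree_of c) n) = enat (gen_size n c)"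
  by (simp add: ecard_def gen_size_def finite_level_tree_of)

lemma measurable_gen_size [measurable]:
  "gen_size n \<in> measurable (gw_offspring \<mu>) (count_space UNIV)"
proof -
  have "(\<lambda>c. the_enat (ecard (level (tree_of c) n))) \<in> measurable (gw_offspring \<mu>) (count_space UNIV)"
    by measurable
  then show ?thesis by (simp add: ecard_level)
qed

lemma measurable_level_eq [measurable]:
  "Measurable.pred (gw_offspring \<mu>) (\<lambda>c. level (tree_of c) n = L)"
proof -
  have "level (tree_of c) n = L \<longleftrightarrow> (\<forall>u. u \<in> tree_of c \<and> length u = n \<longleftrightarrow> u \<in> L)" for c
    by (auto simp: level_def)
  then show ?thesis by simp
qed

section \<open>The branching property\<close>

text \<open>
  Replacing one offspring number by an independent copy does not change the law of the family.
  This is the only form in which independence is used.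
\<close>

lemma nn_integral_gw_resample:
  assumes [measurable]: "g \<in> borel_measurable (gw_offspring \<mu>)"
  shows "(\<integral>\<^sup>+c. g c \<partial>gw_offspring \<mu>) = (\<integral>\<^sup>+c. \<integral>\<^sup>+k. g (c(u := k)) \<partial>measure_pmf \<mu> \<partial>gw_offspring \<mu>)"
proof -
  let ?M = "gw_offspring \<mu>" and ?p = "measure_pmf \<mu>"
  interpret M: prob_space ?M by (rule prob_space_gw_offspring)
  interpret pair_sigma_finite ?p ?M ..
  have upd: "(\<lambda>(k, c). c(u := k)) \<in> measurable (?p \<Otimes>\<^sub>M ?M) ?M"
    unfolding gw_offspring_def split_beta'
    by (rule measurable_fun_upd[where J = UNIV]) auto
  have "distr (?p \<Otimes>\<^sub>M ?M) ?M (\<lambda>(k, c). c(u := k)) = ?M"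
    using distr_pair_PiM_eq_PiM[of UNIV "\<lambda>_. ?p" u]
    by (simp add: gw_offspring_def prob_space_measure_pmf)
  then have "(\<integral>\<^sup>+c. g c \<partial>?M) = (\<integral>\<^sup>+c. g c \<partial>distr (?p \<Otimes>\<^sub>M ?M) ?M (\<lambda>(k, c). c(u := k)))"
    by simp
  also have "\<dots> = (\<integral>\<^sup>+x. g ((\<lambda>(k, c). c(u := k)) x) \<partial>(?p \<Otimes>\<^sub>M ?M))"
    by (rule nn_integral_distr[OF upd]) simp
  also have "\<dots> = (\<integral>\<^sup>+c. \<integral>\<^sup>+k. g (c(u := k)) \<partial>?p \<partial>?M)"
    using measurable_compose[OF upd assms] by (subst nn_integral_snd[symmetric]) (auto simp: split_beta')
  finally show ?thesis .
qed

lemma nn_integral_gw_product: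
  fixes g :: "(node \<Rightarrow> nat) \<Rightarrow> ennreal" and h :: "nat \<Rightarrow> ennreal"
  assumes "finite L" and [measurable]: "g \<in> borel_measurable (gw_offspring \<mu>)"
    and inv: "\<And>c u k. u \<in> L \<Longrightarrow> g (c(u := k)) = g c"
  shows "(\<integral>\<^sup>+c. g c * (\<Prod>u\<in>L. h (c u)) \<partial>gw_offspring \<mu>)
    = (\<integral>\<^sup>+c. g c * (\<integral>\<^sup>+k. h k \<partial>measure_pmf \<mu>) ^ card L \<partial>gw_offspring \<mu>)"
  using assms(1) inv
proof (induction L)
  case (insert u L)
  let ?M = "gw_offspring \<mu>" and ?p = "measure_pmf \<mu>"
  have "(\<integral>\<^sup>+c. g c * (\<Prod>v\<in>insert u L. h (c v)) \<partial>?M)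
     = (\<integral>\<^sup>+c. \<integral>\<^sup>+k. g (c(u := k)) * (\<Prod>v\<in>insert u L. h ((c(u := k)) v)) \<partial>?p \<partial>?M)"
    by (rule nn_integral_gw_resample) measurable
  also have "\<dots> = (\<integral>\<^sup>+c. \<integral>\<^sup>+k. h k * (g c * (\<Prod>v\<in>L. h (c v))) \<partial>?p \<partial>?M)"
  proof (intro nn_integral_cong)
    fix c k
    have "(\<Prod>v\<in>L. h ((c(u := k)) v)) = (\<Prod>v\<in>L. h (c v))"
      using insert.hyps by (intro prod.cong) auto
    moreover have "g (c(u := k)) = g c" by (rule insert.prems) simp
    ultimately show "g (c(u := k)) * (\<Prod>v\<in>insert u L. h ((c(u := k)) v)) = h k * (g c * (\<Prod>v\<in>L. h (c v)))"
      using insert.hyps by (simp add: ac_simps del: fun_upd_apply add: fun_upd_same)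
  qed
  also have "\<dots> = (\<integral>\<^sup>+k. h k \<partial>?p) * (\<integral>\<^sup>+c. g c * (\<Prod>v\<in>L. h (c v)) \<partial>?M)"
    by (simp add: nn_integral_multc nn_integral_cmult)
  also have "\<dots> = (\<integral>\<^sup>+k. h k \<partial>?p) * (\<integral>\<^sup>+c. g c * (\<integral>\<^sup>+k. h k \<partial>?p) ^ card L \<partial>?M)"
    by (subst insert.IH) (rule insert.prems, simp, rule refl)
  also have "\<dots> = (\<integral>\<^sup>+c. g c * (\<integral>\<^sup>+k. h k \<partial>?p) ^ card (insert u L) \<partial>?M)"
    using insert.hyps by (simp add: nn_integral_multc nn_integral_cmult ac_simps)
  finally show ?case .
qed simp

definition gf :: "nat pmf \<Rightarrow> real \<Rightarrow> real" where
  "gf \<mu> s = measure_pmf.expectation \<mu> (\<lambda>i. s ^ i)"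

lemma nn_integral_gf:
  assumes "0 \<le> s" "s \<le> 1"
  shows "(\<integral>\<^sup>+k. ennreal s ^ k \<partial>measure_pmf \<mu>) = ennreal (gf \<mu> s)"
proof -
  have "integrable (measure_pmf \<mu>) (\<lambda>i. s ^ i)"
    using assms by (intro measure_pmf.integrable_const_bound[of _ 1]) (auto simp: power_le_one)
  then show ?thesis
    unfolding gf_def using assms
    by (subst nn_integral_eq_integral[symmetric]) (auto intro!: nn_integral_cong simp: ennreal_power)
qed

text \<open>
  The Markov property of the generation sizes, tested against powers: given the first \<open>n\<close> generations,
  \<open>Z\<^sub>n\<^sub>+\<^sub>1\<close> is the sum of \<open>Z\<^sub>n\<close> independent offspring numbers.  Level \<open>n\<close> is a finite set of words, hence
  takes only countably many values; for each fixed value the previous lemma on products applies.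
\<close>

lemma nn_integral_gen_size_Suc:
  fixes g :: "(node \<Rightarrow> nat) \<Rightarrow> ennreal"
  assumes g [measurable]: "g \<in> borel_measurable (gw_offspring \<mu>)"
    and inv: "\<And>c u k. n \<le> length u \<Longrightarrow> g (c(u := k)) = g c" and s: "0 \<le> s" "s \<le> 1"
  shows "(\<integral>\<^sup>+c. g c * ennreal s ^ gen_size (Suc n) c \<partial>gw_offspring \<mu>)
    = (\<integral>\<^sup>+c. g c * ennreal (gf \<mu> s) ^ gen_size n c \<partial>gw_offspring \<mu>)"
proof -
  let ?M = "gw_offspring \<mu>" and ?X = "\<lambda>c. level (tree_of c) n"
  \<comment> \<open>Level \<open>n\<close> is encoded by a natural number, so that the integral splits into a series.\<close>
  let ?e = "to_nat_on {L::node set. finite L}"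
  let ?A = "\<lambda>i. {c. ?e (?X c) = i}"
  have cnt: "countable {L::node set. finite L}"
    using countable_Collect_finite by simp
  have inj: "?e L = ?e L' \<longleftrightarrow> L = L'" if "finite L" "finite L'" for L L'
    using that cnt by simp
  have A_level: "?A i = {c. ?X c = L}" if "finite L" "?e L = i" for i L
    using that inj finite_level_tree_of by auto
  have A_empty: "?A i = {}" if "\<nexists>L. finite L \<and> ?e L = i" for i
    using that finite_level_tree_of by blast
  have A_sets [measurable]: "?A i \<in> sets ?M" for i
  proof (cases "\<exists>L. finite L \<and> ?e L = i")
    case True
    then obtain L where L: "finite L" "?e L = i" by blast
    have "{c \<in> space ?M. ?X c = L} \<in> sets ?M" by measurable
    then show ?thesis by (simp add: A_level[OF L])
  qed (simp add: A_empty)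
  have split: "(\<integral>\<^sup>+c. F c \<partial>?M) = (\<Sum>i. \<integral>\<^sup>+c. F c * indicator (?A i) c \<partial>?M)"
    if [measurable]: "F \<in> borel_measurable ?M" for F
  proof -
    have "F c = (\<Sum>i. F c * indicator (?A i) c)" for c
      by (rule suminf_cmult_indicator[symmetric]) (auto simp: disjoint_family_on_def)
    then have "(\<integral>\<^sup>+c. F c \<partial>?M) = (\<integral>\<^sup>+c. (\<Sum>i. F c * indicator (?A i) c) \<partial>?M)" by simp
    also have "\<dots> = (\<Sum>i. \<integral>\<^sup>+c. F c * indicator (?A i) c \<partial>?M)"
      by (rule nn_integral_suminf) measurable
    finally show ?thesis .
  qed
  have piece: "(\<integral>\<^sup>+c. g c * ennreal s ^ gen_size (Suc n) c * indicator (?A i) c \<partial>?M)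
      = (\<integral>\<^sup>+c. g c * ennreal (gf \<mu> s) ^ gen_size n c * indicator (?A i) c \<partial>?M)" for i
  proof (cases "\<exists>L. finite L \<and> ?e L = i")
    case True
    then obtain L where L: "finite L" "?e L = i" by blast
    show ?thesis
    proof (cases "\<exists>c. ?X c = L")
      case True
      then have len: "length u = n" if "u \<in> L" for u using that by (auto simp: level_def)
      have "(\<integral>\<^sup>+c. g c * ennreal s ^ gen_size (Suc n) c * indicator (?A i) c \<partial>?M)
          = (\<integral>\<^sup>+c. (g c * indicator {c. ?X c = L} c) * (\<Prod>u\<in>L. ennreal s ^ c u) \<partial>?M)"
        by (intro nn_integral_cong)
          (auto simp: A_level[OF L] gen_size_Suc power_sum split: split_indicator)
      also have "\<dots> = (\<integral>\<^sup>+c. (g c * indicator {c. ?X c = L} c)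
          * (\<integral>\<^sup>+k. ennreal s ^ k \<partial>measure_pmf \<mu>) ^ card L \<partial>?M)"
      proof (rule nn_integral_gw_product)
        show "(\<lambda>c. g c * indicator {c. ?X c = L} c) \<in> borel_measurable ?M"
          using A_sets[of i] unfolding A_level[OF L] by measurable
        show "g (c(u := k)) * indicator {c. ?X c = L} (c(u := k)) = g c * indicator {c. ?X c = L} c"
          if "u \<in> L" for c u k
          using inv[of u c k] len[OF that] by (simp add: indicator_def level_tree_of_update)
      qed (fact L)
      also have "\<dots> = (\<integral>\<^sup>+c. g c * ennreal (gf \<mu> s) ^ gen_size n c * indicator (?A i) c \<partial>?M)"
        by (intro nn_integral_cong)
          (auto simp: A_level[OF L] gen_size_def nn_integral_gf[OF s] split: split_indicator)
      finally show ?thesis .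
    qed (use A_level[OF L] in auto)
  qed (simp add: A_empty)
  show ?thesis by (subst (1 2) split) (simp_all add: piece)
qed

section \<open>Generating function and extinction probability\<close>

lemma integrable_pmf_bounded:
  fixes h :: "nat \<Rightarrow> real"
  assumes "\<And>i. \<bar>h i\<bar> \<le> B"
  shows "integrable (measure_pmf \<mu>) h"
  using assms by (intro measure_pmf.integrable_const_bound[of _ B]) auto

lemma integrable_pow_pmf: "0 \<le> s \<Longrightarrow> s \<le> 1 \<Longrightarrow> integrable (measure_pmf \<mu>) (\<lambda>i. (s::real) ^ i)"
  by (rule integrable_pmf_bounded[of _ 1]) (simp add: power_le_one)

lemma gf_nonneg: "0 \<le> s \<Longrightarrow> 0 \<le> gf \<mu> s"
  by (simp add: gf_def)

lemma gf_mono: "0 \<le> s \<Longrightarrow> s \<le> t \<Longrightarrow> t \<le> 1 \<Longrightarrow> gf \<mu> s \<le> gf \<mu> t"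
  unfolding gf_def by (intro integral_mono integrable_pow_pmf power_mono) auto

lemma gf_1 [simp]: "gf \<mu> 1 = 1"
  by (simp add: gf_def)

lemma gf_le_1: "0 \<le> s \<Longrightarrow> s \<le> 1 \<Longrightarrow> gf \<mu> s \<le> 1"
  using gf_mono[of s 1 \<mu>] by simp

lemma expectation_indicator_pmf: "measure_pmf.expectation \<mu> (\<lambda>i. h i * of_bool (i = j)) = h j * pmf \<mu> j" 
  for h :: "nat \<Rightarrow> real"
proof -
  have "measure_pmf.expectation \<mu> (\<lambda>i. h i * of_bool (i = j)) = (\<Sum>i\<in>{j}. (h i * of_bool (i = j)) * pmf \<mu> i)"
    by (rule integral_measure_pmf_real) auto
  then show ?thesis by simp
qed

text \<open>
  By the Knaster--Tarski argument, this infimum is the smallest fixed point of the monotone map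
  \<^term>\<open>gf \<mu>\<close> on the unit interval.
\<close>

definition ext_prob :: "nat pmf \<Rightarrow> real" where
  "ext_prob \<mu> = Inf {s \<in> {0..1}. gf \<mu> s \<le> s}"

lemma ext_prob_bounds: "0 \<le> ext_prob \<mu>" "ext_prob \<mu> \<le> 1"
proof -
  have 1: "1 \<in> {s \<in> {0..1}. gf \<mu> s \<le> s}" by simp
  then show "0 \<le> ext_prob \<mu>"
    unfolding ext_prob_def by (intro cInf_greatest) auto
  from 1 show "ext_prob \<mu> \<le> 1"
    unfolding ext_prob_def by (intro cInf_lower bdd_belowI[of _ 0]) auto
qed

lemma gf_above_diagonal:
  assumes "0 \<le> s" "s < ext_prob \<mu>" shows "s < gf \<mu> s"
proof (rule ccontr)
  assume "\<not> s < gf \<mu> s"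
  then have "ext_prob \<mu> \<le> s"
    unfolding ext_prob_def using assms ext_prob_bounds[of \<mu>]
    by (intro cInf_lower bdd_belowI[of _ 0]) auto
  with assms show False by simp
qed

lemma gf_ext_prob [simp]: "gf \<mu> (ext_prob \<mu>) = ext_prob \<mu>"
proof (rule antisym)
  let ?q = "ext_prob \<mu>"
  show le: "gf \<mu> ?q \<le> ?q"
  proof (subst (2) ext_prob_def, rule cInf_greatest)
    have "1 \<in> {s \<in> {0..1}. gf \<mu> s \<le> s}" by simp
    then show "{s \<in> {0..1}. gf \<mu> s \<le> s} \<noteq> {}" by blast
    fix s assume s: "s \<in> {s \<in> {0..1}. gf \<mu> s \<le> s}"
    then have "?q \<le> s" unfolding ext_prob_def by (intro cInf_lower bdd_belowI[of _ 0]) auto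
    with s gf_mono[of ?q s \<mu>] ext_prob_bounds[of \<mu>] show "gf \<mu> ?q \<le> s" by auto
  qed
  have "gf \<mu> (gf \<mu> ?q) \<le> gf \<mu> ?q"
    using le gf_mono ext_prob_bounds[of \<mu>] gf_nonneg by blast
  then show "?q \<le> gf \<mu> ?q"
    using gf_above_diagonal[of "gf \<mu> ?q" \<mu>] ext_prob_bounds[of \<mu>] gf_nonneg[of ?q \<mu>] by force
qed

lemma one_diff_power_ratio_mono:
  fixes s t :: real
  assumes "0 \<le> s" "s \<le> t" "t \<le> 1"
  shows "(1 - t) * (1 - s ^ j) \<le> (1 - s) * (1 - t ^ j)"
proof -
  have "(1 - t) * ((1 - s) * (\<Sum>l<j. s ^ l)) \<le> (1 - t) * ((1 - s) * (\<Sum>l<j. t ^ l))"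
    using assms by (intro mult_left_mono sum_mono power_mono) auto
  then show ?thesis by (simp add: one_diff_power_eq ac_simps)
qed

text \<open>
  The next lemmas compare \<^term>\<open>gf \<mu>\<close> with the identity on \<open>[0, q]\<close>.  Dividing by \<open>q\<close>, the weights
  \<open>\<mu>(i) q ^ i\<close> become the offspring law conditioned on extinction.  The function
  \<open>s - s ^ i + [i = 0] (1 - s)\<close> vanishes for \<open>i = 0\<close> and \<open>i = 1\<close>, and is \<open>(1 - s) (s + \<dots> + s ^ (i - 1))\<close>
  for \<open>i \<ge> 2\<close>, so its mean records the contribution of the nodes with several children.
\<close>

lemma integrable_excess:
  assumes r: "0 \<le> r" "r \<le> (1::real)"
  shows "integrable (measure_pmf \<mu>) (\<lambda>i. ext_prob \<mu> ^ i * (r - r ^ i + of_bool (i = 0) * (1 - r)))"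
proof (rule integrable_pmf_bounded[of _ 2])
  fix i
  have "\<bar>r - x + of_bool b * (1 - r)\<bar> \<le> 2" if "0 \<le> x" "x \<le> 1" for x b
    using that r by (cases b) auto
  then have "\<bar>r - r ^ i + of_bool (i = 0) * (1 - r)\<bar> \<le> 2"
    using r by (simp add: power_le_one)
  then have "\<bar>ext_prob \<mu> ^ i * (r - r ^ i + of_bool (i = 0) * (1 - r))\<bar> \<le> 1 * 2"
    unfolding abs_mult using ext_prob_bounds[of \<mu>] by (intro mult_mono) (auto simp: power_le_one)
  then show "\<bar>ext_prob \<mu> ^ i * (r - r ^ i + of_bool (i = 0) * (1 - r))\<bar> \<le> 2" by simp
qed

lemma expectation_excess:
  assumes "0 \<le> s" "s \<le> 1"
  shows "measure_pmf.expectation \<mu> (\<lambda>i. ext_prob \<mu> ^ i * (s - s ^ i + of_bool (i = 0) * (1 - s)))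
    = ext_prob \<mu> * s - gf \<mu> (ext_prob \<mu> * s) + pmf \<mu> 0 * (1 - s)"
proof -
  let ?q = "ext_prob \<mu>"
  have i1: "integrable (measure_pmf \<mu>) (\<lambda>i. ?q ^ i)" and i2: "integrable (measure_pmf \<mu>) (\<lambda>i. (?q * s) ^ i)"
    using assms ext_prob_bounds[of \<mu>] by (auto intro!: integrable_pow_pmf mult_le_one)
  have i3: "integrable (measure_pmf \<mu>) (\<lambda>i. (1 - s) * of_bool (i = 0))"
    by (rule integrable_pmf_bounded[of _ 1]) (use assms in auto)
  have "measure_pmf.expectation \<mu> (\<lambda>i. ?q ^ i * (s - s ^ i + of_bool (i = 0) * (1 - s)))
     = measure_pmf.expectation \<mu> (\<lambda>i. (s * ?q ^ i - (?q * s) ^ i) + (1 - s) * of_bool (i = 0))"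
    by (intro Bochner_Integration.integral_cong) (auto simp: power_mult_distrib algebra_simps)
  also have "\<dots> = s * gf \<mu> ?q - gf \<mu> (?q * s) + (1 - s) * pmf \<mu> 0"
    using i1 i2 i3 expectation_indicator_pmf[of \<mu> "\<lambda>_. 1 - s" 0]
    by (simp add: gf_def)
  finally show ?thesis by (simp add: ac_simps)
qed

text \<open>
  Divided by \<open>s (1 - s)\<close>, the function above becomes a polynomial in \<open>s\<close> with nonnegative coefficients,
  hence increases from \<open>s\<close> to \<open>t\<close>; at \<open>t\<close>, its mean is controlled since \<^term>\<open>gf \<mu>\<close> lies above the
  diagonal.  Sending \<open>t\<close> to 1 replaces the statement that the conditioned law has mean at most 1,
  and avoids differentiating \<^term>\<open>gf \<mu>\<close>.
\<close>

lemma gf_minus_id_lower_chord: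
  assumes s: "0 \<le> s" "s < t" "t < 1"
  shows "t * (ext_prob \<mu> * s - gf \<mu> (ext_prob \<mu> * s) + pmf \<mu> 0 * (1 - s)) \<le> s * (1 - s) * pmf \<mu> 0"
proof -
  let ?q = "ext_prob \<mu>"
  let ?k = "\<lambda>s i. ?q ^ i * (s - s ^ i + of_bool (i = 0) * (1 - s))"
  let ?K = "\<lambda>s. ?q * s - gf \<mu> (?q * s) + pmf \<mu> 0 * (1 - s)"
  note q = ext_prob_bounds[of \<mu>]
  have pt: "t * (1 - t) * ?k s i \<le> s * (1 - s) * ?k t i" for i
  proof (cases i)
    case (Suc j)
    have "(?q ^ i * (s * t)) * ((1 - t) * (1 - s ^ j)) \<le> (?q ^ i * (s * t)) * ((1 - s) * (1 - t ^ j))"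
      using one_diff_power_ratio_mono[of s t j] s q by (intro mult_left_mono) auto
    then show ?thesis by (simp add: Suc algebra_simps)
  qed simp
  have "t * (1 - t) * ?K s = measure_pmf.expectation \<mu> (\<lambda>i. t * (1 - t) * ?k s i)"
    using expectation_excess[of s \<mu>] s by simp
  also have "\<dots> \<le> measure_pmf.expectation \<mu> (\<lambda>i. s * (1 - s) * ?k t i)"
    using s by (intro integral_mono pt integrable_mult_right integrable_excess) auto
  also have "\<dots> = s * (1 - s) * ?K t"
    using expectation_excess[of t \<mu>] s by simp
  also have "\<dots> \<le> s * (1 - s) * (pmf \<mu> 0 * (1 - t))"
  proof -
    have "?q * t \<le> gf \<mu> (?q * t)"
    proof (cases "?q = 0")
      case False
      then show ?thesis using gf_above_diagonal[of "?q * t" \<mu>] s q by (simp add: less_imp_le)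
    qed (simp add: gf_nonneg)
    then show ?thesis using s by (intro mult_left_mono) auto
  qed
  finally have "(1 - t) * (t * ?K s) \<le> (1 - t) * (s * (1 - s) * pmf \<mu> 0)"
    by (simp add: ac_simps)
  then show ?thesis using s by simp
qed

lemma gf_minus_id_lower:
  assumes s: "0 \<le> s" "s \<le> 1"
  shows "ext_prob \<mu> * s + pmf \<mu> 0 * (1 - s)\<^sup>2 \<le> gf \<mu> (ext_prob \<mu> * s)"
proof (cases "s = 1")
  case False
  let ?q = "ext_prob \<mu>"
  let ?K = "?q * s - gf \<mu> (?q * s) + pmf \<mu> 0 * (1 - s)"
  have "?K \<le> s * (1 - s) * pmf \<mu> 0"
  proof (rule field_le_mult_one_interval)
    fix t :: real assume t: "0 < t" "t < 1"
    \<comment> \<open>The chord bound is available only for arguments above \<open>s\<close>.\<close>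
    have *: "max t ((1 + s) / 2) * ?K \<le> s * (1 - s) * pmf \<mu> 0"
      using s False t by (intro gf_minus_id_lower_chord) (auto simp: less_max_iff_disj)
    show "t * ?K \<le> s * (1 - s) * pmf \<mu> 0"
    proof (cases "0 \<le> ?K")
      case True
      then have "t * ?K \<le> max t ((1 + s) / 2) * ?K" by (intro mult_right_mono) auto
      with * show ?thesis by linarith
    next
      case False
      then have "t * ?K \<le> 0" using t by (simp add: mult_le_0_iff)
      also have "0 \<le> s * (1 - s) * pmf \<mu> 0" using s by simp
      finally show ?thesis .
    qed
  qed
  then show ?thesis by (simp add: power2_eq_square algebra_simps)
qed simp

text \<open>
  A law of mean at most 1 gives at least as much mass to 0 as to \<open>{2, 3, \<dots>}\<close>.  For the conditioned law,
  these two masses add up to \<open>1 - \<mu>(1)\<close>, because conditioning on extinction preserves the mass of 1.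
\<close>

lemma pmf_0_lower_bound: "ext_prob \<mu> * (1 - pmf \<mu> 1) \<le> 2 * pmf \<mu> 0"
proof -
  let ?q = "ext_prob \<mu>"
  let ?h = "\<lambda>i. ?q ^ i - 1 * of_bool (i = 0) - ?q * of_bool (i = 1)"
  let ?k = "\<lambda>i. ?q ^ i * (1/2 - (1/2) ^ i + of_bool (i = 0) * (1 - 1/2))"
  note q = ext_prob_bounds[of \<mu>]
  have i0: "integrable (measure_pmf \<mu>) (\<lambda>i. ?q ^ i)" using q by (intro integrable_pow_pmf)
  have i1: "integrable (measure_pmf \<mu>) (\<lambda>i. c * of_bool (i = j))" for c :: real and j
    by (rule integrable_pmf_bounded[of _ "\<bar>c\<bar>"]) auto
  \<comment> \<open>Any fixed \<open>s\<close> in the open unit interval would do in place of \<open>1/2\<close>.\<close>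
  have pt: "1/4 * ?h i \<le> ?k i" for i
  proof -
    consider "i = 0" | "i = 1" | "2 \<le> i" by linarith
    then show ?thesis
    proof cases
      case 3
      then have "(1/2::real) ^ i \<le> (1/2) ^ 2" by (intro power_decreasing) auto
      then have "?q ^ i * (1/4) \<le> ?q ^ i * (1/2 - (1/2) ^ i)"
        using q by (intro mult_left_mono) (auto simp: power2_eq_square)
      with 3 show ?thesis by simp
    qed auto
  qed
  have "1/4 * (?q - pmf \<mu> 0 - ?q * pmf \<mu> 1) = 1/4 * measure_pmf.expectation \<mu> ?h"
    using i0 i1[of 1 0] i1[of ?q 1] expectation_indicator_pmf[of \<mu> "\<lambda>_. 1" 0]
      expectation_indicator_pmf[of \<mu> "\<lambda>_. ?q" 1] gf_ext_prob[of \<mu>]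
    by (auto simp: gf_def)
  also have "\<dots> = measure_pmf.expectation \<mu> (\<lambda>i. 1/4 * ?h i)" by simp
  also have "\<dots> \<le> measure_pmf.expectation \<mu> ?k"
    by (intro integral_mono pt integrable_mult_right Bochner_Integration.integrable_diff i0 i1
        integrable_excess) auto
  also have "\<dots> = ?q * (1/2) - gf \<mu> (?q * (1/2)) + pmf \<mu> 0 * (1 - 1/2)"
    by (rule expectation_excess) auto
  also have "\<dots> \<le> 1/4 * pmf \<mu> 0"
    using gf_minus_id_lower[of "1/2" \<mu>] by (simp add: power2_eq_square)
  finally show ?thesis by (simp add: algebra_simps)
qed

lemma gf_iterate_mem: "0 \<le> s \<Longrightarrow> s \<le> 1 \<Longrightarrow> (gf \<mu> ^^ n) s \<in> {0..1}"
  by (induction n) (auto simp: gf_nonneg gf_le_1)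

lemma gf_iterate_ext_prob [simp]: "(gf \<mu> ^^ n) (ext_prob \<mu>) = ext_prob \<mu>"
  by (induction n) auto

lemma gf_iterate_0_le_ext_prob: "(gf \<mu> ^^ n) 0 \<le> ext_prob \<mu>"
proof (induction n)
  case (Suc n)
  then have "gf \<mu> ((gf \<mu> ^^ n) 0) \<le> gf \<mu> (ext_prob \<mu>)"
    using gf_iterate_mem[of 0 n \<mu>] ext_prob_bounds[of \<mu>] by (intro gf_mono) auto
  then show ?case by simp
qed (simp add: ext_prob_bounds)

lemma logistic_mono:
  fixes u v \<sigma> :: real
  assumes "0 \<le> \<sigma>" "\<sigma> \<le> 1" "u \<le> v" "v \<le> 1"
  shows "u - \<sigma> / 2 * u\<^sup>2 \<le> v - \<sigma> / 2 * v\<^sup>2"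
proof -
  have "\<sigma> * (u + v) \<le> \<sigma> * 2" using assms by (intro mult_left_mono) auto
  then have "0 \<le> (v - u) * (1 - \<sigma> / 2 * (u + v))"
    using assms by (intro mult_nonneg_nonneg) auto
  then show ?thesis by (simp add: power2_eq_square algebra_simps diff_divide_distrib)
qed

text \<open>
  The left-hand side is the probability that generation \<open>n\<close> is nonempty but the tree is finite.  Divided by
  \<open>q\<close>, it satisfies \<open>u\<^sub>n\<^sub>+\<^sub>1 \<le> u\<^sub>n - (\<sigma> / 2) u\<^sub>n\<^sup>2\<close>, so \<open>1 / u\<^sub>n\<close> grows by at least \<open>\<sigma> / 2\<close> in each step.
\<close>

lemma gf_iterate_0_bound:
  assumes "ext_prob \<mu> > 0"
  shows "ext_prob \<mu> - (gf \<mu> ^^ n) 0 \<le> ext_prob \<mu> / (1 + (1 - pmf \<mu> 1) / 2 * real n)"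
proof -
  let ?q = "ext_prob \<mu>"
  define \<sigma> where "\<sigma> = 1 - pmf \<mu> 1"
  define u where "u n = 1 - (gf \<mu> ^^ n) 0 / ?q" for n
  have sig: "0 \<le> \<sigma>" "\<sigma> \<le> 1" by (auto simp: \<sigma>_def pmf_le_1)
  have u01: "0 \<le> u n" "u n \<le> 1" for n
    using gf_iterate_0_le_ext_prob[of n \<mu>] gf_iterate_mem[of 0 n \<mu>] assms
    by (auto simp: u_def)
  have iter: "(gf \<mu> ^^ n) 0 = ?q * (1 - u n)" for n
    using assms by (simp add: u_def)
  have u_Suc: "u (Suc n) \<le> u n - \<sigma> / 2 * (u n)\<^sup>2" for n
  proof -
    have "?q * (1 - u n) + (?q * \<sigma> / 2) * (u n)\<^sup>2 \<le> ?q * (1 - u n) + pmf \<mu> 0 * (1 - (1 - u n))\<^sup>2"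
    proof -
      have "(?q * \<sigma> / 2) * (u n)\<^sup>2 \<le> pmf \<mu> 0 * (u n)\<^sup>2"
        using pmf_0_lower_bound[of \<mu>] by (intro mult_right_mono) (auto simp: \<sigma>_def)
      then show ?thesis by simp
    qed
    also have "\<dots> \<le> gf \<mu> (?q * (1 - u n))"
      using u01[of n] by (intro gf_minus_id_lower) auto
    also have "\<dots> = ?q * (1 - u (Suc n))"
      using iter[of n] iter[of "Suc n"] by simp
    finally have "?q * (1 - u n + \<sigma> / 2 * (u n)\<^sup>2) \<le> ?q * (1 - u (Suc n))"
      by (simp add: algebra_simps)
    then show ?thesis using assms by simp
  qed
  have "u n \<le> 1 / (1 + \<sigma> / 2 * real n)"
  proof (induction n)
    case (Suc n)
    define D where "D = 1 + \<sigma> / 2 * real n"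
    have D: "1 \<le> D" using sig by (simp add: D_def)
    have IH: "u n \<le> 1 / D" using Suc by (simp add: D_def)
    have "u n - \<sigma> / 2 * (u n)\<^sup>2 \<le> 1 / D - \<sigma> / 2 * (1 / D)\<^sup>2"
      using sig D IH by (intro logistic_mono) auto
    also have "\<dots> = (D - \<sigma> / 2) / D\<^sup>2"
      using D by (simp add: power2_eq_square field_simps)
    also have "\<dots> \<le> 1 / (D + \<sigma> / 2)"
    proof -
      have "(D - \<sigma> / 2) * (D + \<sigma> / 2) \<le> D\<^sup>2"
        using zero_le_power2[of \<sigma>] by (simp add: power2_eq_square algebra_simps)
      moreover have "0 < D + \<sigma> / 2" using D sig by linarith
      ultimately show ?thesis using D by (simp add: pos_divide_le_eq pos_le_divide_eq)
    qed
    also have "D + \<sigma> / 2 = 1 + \<sigma> / 2 * real (Suc n)"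
      by (simp add: D_def algebra_simps)
    finally show ?case using u_Suc[of n] by linarith
  qed (simp add: u_def)
  then have "?q * u n \<le> ?q * (1 / (1 + \<sigma> / 2 * real n))"
    using assms by (intro mult_left_mono) auto
  then show ?thesis using assms by (simp add: u_def \<sigma>_def algebra_simps)
qed

lemma gf_0: "gf \<mu> 0 = pmf \<mu> 0"
proof -
  have "gf \<mu> 0 = measure_pmf.expectation \<mu> (\<lambda>i. 1 * of_bool (i = 0))"
    unfolding gf_def by (intro Bochner_Integration.integral_cong) (auto simp: power_0_left)
  then show ?thesis using expectation_indicator_pmf[of \<mu> "\<lambda>_. 1" 0] by simp
qed

lemma gf_upper_bound:
  assumes s: "0 \<le> s" "s \<le> 1"
  shows "gf \<mu> s \<le> s * (1 - (1 - pmf \<mu> 1) * (1 - s)) + pmf \<mu> 0"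
proof -
  have i1: "integrable (measure_pmf \<mu>) (\<lambda>i. c * of_bool (i = j))" for c :: real and j
    by (rule integrable_pmf_bounded[of _ "\<bar>c\<bar>"]) auto
  have "gf \<mu> s \<le> measure_pmf.expectation \<mu> (\<lambda>i. s\<^sup>2 + (s - s\<^sup>2) * of_bool (i = 1) + 1 * of_bool (i = 0))"
    unfolding gf_def
  proof (intro integral_mono integrable_pow_pmf s Bochner_Integration.integrable_add i1)
    fix i :: nat
    consider "i = 0" | "i = 1" | "2 \<le> i" by linarith
    then show "s ^ i \<le> s\<^sup>2 + (s - s\<^sup>2) * of_bool (i = 1) + 1 * of_bool (i = 0)"
    proof cases
      case 3
      then have "s ^ i \<le> s ^ 2" using s by (intro power_decreasing) auto
      with 3 show ?thesis by simp
    qed auto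
  qed simp
  also have "\<dots> = s\<^sup>2 + (s - s\<^sup>2) * pmf \<mu> 1 + pmf \<mu> 0"
  proof -
    have "measure_pmf.expectation \<mu> (\<lambda>i. s\<^sup>2 + (s - s\<^sup>2) * of_bool (i = 1) + 1 * of_bool (i = 0))
      = s\<^sup>2 + measure_pmf.expectation \<mu> (\<lambda>i. (s - s\<^sup>2) * of_bool (i = 1))
        + measure_pmf.expectation \<mu> (\<lambda>i. 1 * of_bool (i = 0))"
      using i1[of "s - s\<^sup>2" 1] i1[of 1 0] by simp
    then show ?thesis
      unfolding expectation_indicator_pmf[of \<mu> "\<lambda>_. s - s\<^sup>2" 1] expectation_indicator_pmf[of \<mu> "\<lambda>_. 1" 0] by simp
  qed
  finally show ?thesis by (simp add: power2_eq_square algebra_simps)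
qed

text \<open>
  For \<open>q > 0\<close>, the fixed point \<open>s = q\<close> works by the bound above.  For \<open>q = 0\<close> there are no leaves, and the
  iterates from \<open>1 / 2\<close> tend to 0 geometrically because a node has at least two children with
  probability \<open>\<sigma> > 0\<close>.
\<close>

lemma gf_iterates_merge:
  assumes \<sigma>: "0 < 1 - pmf \<mu> 1"
  obtains s where "0 < s" "s \<le> 1" "(\<lambda>n. (gf \<mu> ^^ n) s - (gf \<mu> ^^ n) 0) \<longlonglongrightarrow> 0"
proof (cases "ext_prob \<mu> = 0")
  case False
  then have q: "0 < ext_prob \<mu>" "ext_prob \<mu> \<le> 1" using ext_prob_bounds[of \<mu>] by auto
  have "(\<lambda>n. ext_prob \<mu> / (1 + (1 - pmf \<mu> 1) / 2 * real n)) \<longlonglongrightarrow> 0"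
    using \<sigma> by real_asymp
  then have "(\<lambda>n. (gf \<mu> ^^ n) (ext_prob \<mu>) - (gf \<mu> ^^ n) 0) \<longlonglongrightarrow> 0"
  proof (rule tendsto_sandwich[OF _ _ tendsto_const, rotated 2])
    show "\<forall>\<^sub>F n in sequentially. (gf \<mu> ^^ n) (ext_prob \<mu>) - (gf \<mu> ^^ n) 0
        \<le> ext_prob \<mu> / (1 + (1 - pmf \<mu> 1) / 2 * real n)"
      unfolding gf_iterate_ext_prob by (intro always_eventually allI gf_iterate_0_bound q)
  qed (simp add: gf_iterate_0_le_ext_prob)
  with that q show thesis by blast
next
  case True
  define \<theta> where "\<theta> = 1 - (1 - pmf \<mu> 1) / 2"
  have \<theta>: "0 \<le> \<theta>" "\<theta> < 1" using \<sigma> by (auto simp: \<theta>_def intro: order_trans[OF _ pmf_nonneg])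
  have "pmf \<mu> 0 \<le> 0" using gf_iterate_0_le_ext_prob[of 1 \<mu>] True by (simp add: gf_0)
  then have no_leaves: "pmf \<mu> 0 = 0" using pmf_nonneg[of \<mu> 0] by linarith
  have iter: "(gf \<mu> ^^ n) (1/2) \<in> {0..1/2 * \<theta> ^ n}" for n
  proof (induction n)
    case (Suc n)
    let ?s = "(gf \<mu> ^^ n) (1/2)"
    have s: "0 \<le> ?s" "?s \<le> 1/2 * \<theta> ^ n" "?s \<le> 1/2"
      using Suc power_le_one[of \<theta> n] \<theta> by auto
    have "gf \<mu> ?s \<le> ?s * (1 - (1 - pmf \<mu> 1) * (1 - ?s))"
      using gf_upper_bound[of ?s \<mu>] s no_leaves by simp
    also have "\<dots> \<le> ?s * \<theta>"
    proof (intro mult_left_mono s)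
      have "(1 - pmf \<mu> 1) * (1 / 2) \<le> (1 - pmf \<mu> 1) * (1 - ?s)"
        using \<sigma> s by (intro mult_left_mono) auto
      then show "1 - (1 - pmf \<mu> 1) * (1 - ?s) \<le> \<theta>" by (simp add: \<theta>_def)
    qed
    also have "\<dots> \<le> (1/2 * \<theta> ^ n) * \<theta>" using s \<theta> by (intro mult_right_mono) auto
    finally show ?case using gf_nonneg[OF s(1), of \<mu>] by (simp add: ac_simps)
  qed simp
  have "(\<lambda>n. 1/2 * \<theta> ^ n) \<longlonglongrightarrow> 1/2 * 0"
    using \<theta> by (intro tendsto_mult tendsto_const LIMSEQ_power_zero) auto
  then have "(\<lambda>n. 1/2 * \<theta> ^ n) \<longlonglongrightarrow> 0" by simp
  then have "(\<lambda>n. (gf \<mu> ^^ n) (1/2)) \<longlonglongrightarrow> 0"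
    by (rule tendsto_sandwich[OF _ _ tendsto_const, rotated 2]) (use iter in auto)
  moreover have "(gf \<mu> ^^ n) 0 = 0" for n
    using gf_iterate_0_le_ext_prob[of n \<mu>] gf_iterate_mem[of 0 n \<mu>] True by auto
  ultimately show thesis by (intro that[of "1/2"]) auto
qed

section \<open>Generations of small size\<close>

lemma integrable_gw_bounded:
  fixes g :: "(node \<Rightarrow> nat) \<Rightarrow> real"
  assumes "g \<in> borel_measurable (gw_offspring \<mu>)" "\<And>c. \<bar>g c\<bar> \<le> B"
  shows "integrable (gw_offspring \<mu>) g"
proof -
  interpret prob_space "gw_offspring \<mu>" by (rule prob_space_gw_offspring)
  show ?thesis using assms by (intro integrable_const_bound[of _ B]) auto
qed

lemma integral_gen_size_iterate:
  fixes g :: "(node \<Rightarrow> nat) \<Rightarrow> real"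
  assumes [measurable]: "g \<in> borel_measurable (gw_offspring \<mu>)" and nonneg: "\<And>c. 0 \<le> g c"
    and inv: "\<And>c u k. n \<le> length u \<Longrightarrow> g (c(u := k)) = g c" and s: "0 \<le> s" "s \<le> 1"
  shows "(\<integral>c. g c * s ^ gen_size (n + m) c \<partial>gw_offspring \<mu>)
    = (\<integral>c. g c * (gf \<mu> ^^ m) s ^ gen_size n c \<partial>gw_offspring \<mu>)"
  using s
proof (induction m arbitrary: s)
  case (Suc m)
  let ?M = "gw_offspring \<mu>"
  have eq: "ennreal (g c * t ^ k) = ennreal (g c) * ennreal t ^ k" if "0 \<le> t" for c t k
    using that nonneg by (simp add: ennreal_mult ennreal_power)
  have "(\<integral>c. g c * s ^ gen_size (n + Suc m) c \<partial>?M)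
      = enn2real (\<integral>\<^sup>+c. ennreal (g c) * ennreal s ^ gen_size (Suc (n + m)) c \<partial>?M)"
    using Suc.prems nonneg by (subst integral_eq_nn_integral) (auto simp: eq)
  also have "\<dots> = enn2real (\<integral>\<^sup>+c. ennreal (g c) * ennreal (gf \<mu> s) ^ gen_size (n + m) c \<partial>?M)"
    using Suc.prems inv by (subst nn_integral_gen_size_Suc) auto
  also have "\<dots> = (\<integral>c. g c * gf \<mu> s ^ gen_size (n + m) c \<partial>?M)"
    using Suc.prems nonneg gf_nonneg[of s \<mu>] by (subst integral_eq_nn_integral) (auto simp: eq)
  also have "\<dots> = (\<integral>c. g c * (gf \<mu> ^^ m) (gf \<mu> s) ^ gen_size n c \<partial>?M)"
    using Suc.prems by (intro Suc.IH) (auto simp: gf_nonneg gf_le_1)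
  finally show ?case by (simp add: funpow_swap1)
qed simp

lemma integral_gen_size:
  assumes "0 \<le> s" "s \<le> 1"
  shows "(\<integral>c. s ^ gen_size n c \<partial>gw_offspring \<mu>) = (gf \<mu> ^^ n) s"
proof -
  interpret prob_space "gw_offspring \<mu>" by (rule prob_space_gw_offspring)
  show ?thesis
    using integral_gen_size_iterate[of "\<lambda>_. 1" \<mu> 0 s n] assms prob_space by simp
qed

definition small_gen :: "nat \<Rightarrow> (node \<Rightarrow> nat) \<Rightarrow> nat \<Rightarrow> bool" where
  "small_gen w c i \<longleftrightarrow> 1 \<le> gen_size i c \<and> gen_size i c \<le> w"

lemma measurable_small_gen [measurable]:
  "Measurable.pred (gw_offspring \<mu>) (\<lambda>c. small_gen w c i)"
  unfolding small_gen_def by measurable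

text \<open>
  The factor 4/3 per small generation and the potential \<open>2 q ^ z - [z = 0]\<close> are matched: the potential is 1
  at extinction and \<open>2 q ^ z\<close> before it, so a probability of at least \<open>q ^ z / 2\<close> of dying out lowers its
  mean from \<open>2 q ^ z\<close> to at most \<open>(3/2) q ^ z\<close>, by the factor 3/4.
\<close>

definition reward :: "nat \<Rightarrow> nat \<Rightarrow> nat \<Rightarrow> nat \<Rightarrow> (node \<Rightarrow> nat) \<Rightarrow> real" where
  "reward w m r J c = (\<Prod>j<J. if small_gen w c (r + j * m) then 4/3 else 1)"

definition potential :: "real \<Rightarrow> nat \<Rightarrow> real" where
  "potential q z = 2 * q ^ z - 0 ^ z"

lemma potential_nonneg: "0 \<le> q \<Longrightarrow> 0 \<le> potential q z"
  by (cases z) (auto simp: potential_def)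

lemma potential_le: "0 \<le> q \<Longrightarrow> potential q z \<le> 2 * q ^ z"
  by (cases z) (auto simp: potential_def)

lemma measurable_reward [measurable]: "reward w m r J \<in> borel_measurable (gw_offspring \<mu>)"
  unfolding reward_def by measurable

lemma reward_nonneg: "0 \<le> reward w m r J c"
  unfolding reward_def by (intro prod_nonneg) auto

lemma reward_le: "reward w m r J c \<le> (4/3) ^ J"
proof -
  have "reward w m r J c \<le> (\<Prod>j<J. 4/3)" unfolding reward_def by (intro prod_mono) auto
  then show ?thesis by simp
qed

lemma reward_update:
  assumes "r + J * m \<le> length u + m" 
  shows "reward w m r J (c(u := k)) = reward w m r J c"
  unfolding reward_def
proof (intro prod.cong refl)
  fix j assume "j \<in> {..<J}"
  then have "Suc j * m \<le> J * m" by (intro mult_right_mono) auto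
  then have "r + j * m \<le> length u" using assms by simp
  then show "(if small_gen w (c(u := k)) (r + j * m) then 4/3 else 1 :: real)
      = (if small_gen w c (r + j * m) then 4/3 else 1)"
    by (simp add: small_gen_def gen_size_update del: fun_upd_apply)
qed

text \<open>
  The product of reward and potential is a supermartingale along the times \<open>r + J * m\<close>.  The hypothesis
  \<open>half\<close> says that \<open>z \<le> w\<close> individuals bound for extinction have no descendants after \<open>m\<close> generations with
  conditional probability at least 1/2; in generations larger than \<open>w\<close> no reward is paid, and it
  suffices that \<open>q ^ Z\<close> is a martingale.
\<close>

lemma expected_reward_le:
  fixes \<mu> :: "nat pmf"
  defines "q \<equiv> ext_prob \<mu>" and "M \<equiv> gw_offspring \<mu>"
  assumes half: "\<And>z. 1 \<le> z \<Longrightarrow> z \<le> w \<Longrightarrow> q ^ z \<le> 2 * (gf \<mu> ^^ m) 0 ^ z"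
    and [measurable]: "\<phi> \<in> borel_measurable M" and \<phi>: "\<And>c. 0 \<le> \<phi> c" "\<And>c. \<phi> c \<le> 1"
    and inv: "\<And>c u k. r \<le> length u \<Longrightarrow> \<phi> (c(u := k)) = \<phi> c"
  shows "(\<integral>c. \<phi> c * reward w m r J c * potential q (gen_size (r + J * m) c) \<partial>M)
    \<le> (\<integral>c. \<phi> c * potential q (gen_size r c) \<partial>M)"
proof (induction J)
  case (Suc J)
  note [measurable] = measurable_reward[of _ _ _ _ \<mu>, folded M_def] measurable_gen_size[of _ \<mu>, folded M_def]
  let ?n = "r + J * m" and ?p = "(gf \<mu> ^^ m) 0"
  have q: "0 \<le> q" "q \<le> 1" using ext_prob_bounds by (auto simp: q_def)
  have p: "0 \<le> ?p" "?p \<le> 1" using gf_iterate_mem[of 0 m \<mu>] by auto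
  define G where "G c = \<phi> c * reward w m r (Suc J) c" for c
  have G [measurable]: "G \<in> borel_measurable M" unfolding G_def by measurable
  have G0: "0 \<le> G c" for c by (simp add: G_def \<phi> reward_nonneg)
  have GB: "G c \<le> (4/3) ^ Suc J" for c
  proof -
    have "\<phi> c * reward w m r (Suc J) c \<le> 1 * (4/3) ^ Suc J"
      by (intro mult_mono \<phi> reward_nonneg reward_le) auto
    then show ?thesis by (simp add: G_def)
  qed
  have Ginv: "G (c(u := k)) = G c" if "?n \<le> length u" for c u k
    unfolding G_def using that inv[of u c k] reward_update[of r "Suc J" m u w c k] by simp
  have int: "integrable M (\<lambda>c. G c * s ^ gen_size i c)" if "0 \<le> s" "s \<le> 1" for s i
    unfolding M_def
  proof (rule integrable_gw_bounded)
    show "(\<lambda>c. G c * s ^ gen_size i c) \<in> borel_measurable (gw_offspring \<mu>)"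
      unfolding M_def[symmetric] by measurable
    show "\<bar>G c * s ^ gen_size i c\<bar> \<le> (4/3) ^ Suc J" for c
      using mult_mono[OF GB[of c] power_le_one[OF that, of "gen_size i c"]] G0[of c] that
      by (simp add: abs_mult)
  qed
  have step: "(\<integral>c. G c * s ^ gen_size (r + Suc J * m) c \<partial>M) = (\<integral>c. G c * (gf \<mu> ^^ m) s ^ gen_size ?n c \<partial>M)"
    if "0 \<le> s" "s \<le> 1" for s
    using integral_gen_size_iterate[of G \<mu> ?n s m] G G0 Ginv that
    by (simp add: M_def ac_simps)
  have "(\<integral>c. \<phi> c * reward w m r (Suc J) c * potential q (gen_size (r + Suc J * m) c) \<partial>M)
      = (\<integral>c. 2 * (G c * q ^ gen_size (r + Suc J * m) c) - G c * 0 ^ gen_size (r + Suc J * m) c \<partial>M)"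
    by (intro Bochner_Integration.integral_cong) (auto simp: G_def potential_def algebra_simps)
  also have "\<dots> = 2 * (\<integral>c. G c * q ^ gen_size (r + Suc J * m) c \<partial>M)
      - (\<integral>c. G c * 0 ^ gen_size (r + Suc J * m) c \<partial>M)"
    using int[OF q] int[of 0] by simp
  also have "\<dots> = 2 * (\<integral>c. G c * q ^ gen_size ?n c \<partial>M) - (\<integral>c. G c * ?p ^ gen_size ?n c \<partial>M)"
    using step[OF q] step[of 0] by (simp add: q_def)
  also have "\<dots> = (\<integral>c. 2 * (G c * q ^ gen_size ?n c) - G c * ?p ^ gen_size ?n c \<partial>M)"
    using int[OF q] int[OF p] by simp
  also have "\<dots> \<le> (\<integral>c. \<phi> c * reward w m r J c * potential q (gen_size ?n c) \<partial>M)"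
  proof (rule integral_mono)
    show "integrable M (\<lambda>c. 2 * (G c * q ^ gen_size ?n c) - G c * ?p ^ gen_size ?n c)"
      using int[OF q] int[OF p] by simp
    show "integrable M (\<lambda>c. \<phi> c * reward w m r J c * potential q (gen_size ?n c))"
      unfolding M_def
    proof (rule integrable_gw_bounded)
      show "(\<lambda>c. \<phi> c * reward w m r J c * potential q (gen_size ?n c)) \<in> borel_measurable (gw_offspring \<mu>)"
        unfolding M_def[symmetric] by measurable
      fix c
      have "potential q (gen_size ?n c) \<le> 2"
        using potential_le[OF q(1), of "gen_size ?n c"] power_le_one[OF q, of "gen_size ?n c"] by linarith
      then have "(\<phi> c * reward w m r J c) * potential q (gen_size ?n c) \<le> (1 * (4/3) ^ J) * 2"
        using \<phi> reward_nonneg reward_le potential_nonneg[OF q(1)]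
        by (intro mult_mono) (auto intro!: mult_nonneg_nonneg)
      then show "\<bar>\<phi> c * reward w m r J c * potential q (gen_size ?n c)\<bar> \<le> (1 * (4/3) ^ J) * 2"
        using \<phi> reward_nonneg potential_nonneg[OF q(1)] by (simp add: abs_mult)
    qed
    fix c
    let ?z = "gen_size ?n c"
    have key: "(if small_gen w c ?n then 4/3 else 1) * (2 * q ^ ?z - ?p ^ ?z) \<le> potential q ?z"
    proof -
      consider "?z = 0" | "1 \<le> ?z" "?z \<le> w" | "1 \<le> ?z" "w < ?z" by linarith
      then show ?thesis
      proof cases
        case 2
        then have "0 ^ ?z = (0::real)" by simp
        moreover have "small_gen w c ?n" using 2 by (simp add: small_gen_def)
        ultimately show ?thesis using half[OF 2] unfolding potential_def by (simp only:) simp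
      next
        case 3
        then show ?thesis using p by (simp add: small_gen_def potential_def)
      qed (simp add: small_gen_def potential_def)
    qed
    have "2 * (G c * q ^ ?z) - G c * ?p ^ ?z
        = (\<phi> c * reward w m r J c) * ((if small_gen w c ?n then 4/3 else 1) * (2 * q ^ ?z - ?p ^ ?z))"
      by (simp add: G_def reward_def algebra_simps)
    also have "\<dots> \<le> (\<phi> c * reward w m r J c) * potential q ?z"
      using key \<phi> reward_nonneg by (intro mult_left_mono) auto
    finally show "2 * (G c * q ^ ?z) - G c * ?p ^ ?z \<le> \<phi> c * reward w m r J c * potential q ?z" .
  qed
  also note Suc.IH
  finally show ?case .
qed (simp add: reward_def)

text \<open>
  Restricting to trees that are alive at time \<open>t\<close> bounds the initial value of the supermartingale by twice
  the probability that the tree is finite but alive at time \<open>t\<close>.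
\<close>

lemma expected_reward_alive_le:
  fixes \<mu> :: "nat pmf"
  defines "q \<equiv> ext_prob \<mu>" and "M \<equiv> gw_offspring \<mu>"
  assumes half: "\<And>z. 1 \<le> z \<Longrightarrow> z \<le> w \<Longrightarrow> q ^ z \<le> 2 * (gf \<mu> ^^ m) 0 ^ z"
    and "t \<le> r"
  shows "(\<integral>c. (1 - 0 ^ gen_size t c) * reward w m r J c * potential q (gen_size (r + J * m) c) \<partial>M)
    \<le> 2 * (q - (gf \<mu> ^^ t) 0)"
proof -
  note [measurable] = measurable_gen_size[of _ \<mu>, folded M_def]
  let ?a = "\<lambda>c. 1 - 0 ^ gen_size t c :: real"
  have q: "0 \<le> q" "q \<le> 1" using ext_prob_bounds by (auto simp: q_def)
  have a: "0 \<le> ?a c" "?a c \<le> 1" for c by (auto simp: power_le_one)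
  have inv: "?a (c(u := k)) = ?a c" if "t \<le> length u" for c u k
    using that by (simp add: gen_size_update)
  have am: "?a \<in> borel_measurable (gw_offspring \<mu>)" unfolding M_def[symmetric] by measurable
  have int: "integrable M (\<lambda>c. s ^ gen_size i c)" if "0 \<le> s" "s \<le> 1" for s :: real and i
    unfolding M_def using that
    by (intro integrable_gw_bounded[where B = 1]) (auto simp: power_le_one M_def[symmetric])
  have inta: "integrable M (\<lambda>c. ?a c * x c)" 
    if [measurable]: "x \<in> borel_measurable M" and "\<And>c. 0 \<le> x c \<and> x c \<le> 2" for x :: "(node \<Rightarrow> nat) \<Rightarrow> real"
    unfolding M_def
  proof (intro integrable_gw_bounded[where B = 2])
    show "(\<lambda>c. ?a c * x c) \<in> borel_measurable (gw_offspring \<mu>)" unfolding M_def[symmetric] by measurable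
    show "\<bar>?a c * x c\<bar> \<le> 2" for c
      using mult_mono[OF a(2)[of c], of "x c" 2] that(2)[of c] a(1)[of c] by (simp add: abs_mult)
  qed
  have qz: "0 \<le> q ^ z \<and> q ^ z \<le> 1" for z using q by (simp add: power_le_one)
  have "(\<integral>c. ?a c * reward w m r J c * potential q (gen_size (r + J * m) c) \<partial>M)
      \<le> (\<integral>c. ?a c * potential q (gen_size r c) \<partial>M)"
    unfolding q_def M_def using half inv a am \<open>t \<le> r\<close>
    by (intro expected_reward_le) (auto simp: q_def)
  also have "\<dots> \<le> (\<integral>c. ?a c * (2 * q ^ gen_size r c) \<partial>M)"
  proof (intro integral_mono inta mult_left_mono potential_le q conjI potential_nonneg a)
    show "(\<lambda>c. potential q (gen_size r c)) \<in> borel_measurable M"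
      "(\<lambda>c. 2 * q ^ gen_size r c) \<in> borel_measurable M" by measurable
    show "potential q (gen_size r c) \<le> 2" for c
      using potential_le[OF q(1), of "gen_size r c"] qz[of "gen_size r c"] by linarith
  qed (use qz q in auto)
  also have "\<dots> = 2 * (\<integral>c. ?a c * q ^ gen_size (t + (r - t)) c \<partial>M)"
    using \<open>t \<le> r\<close> by (simp add: mult.left_commute)
  also have "\<dots> = 2 * (\<integral>c. ?a c * q ^ gen_size t c \<partial>M)"
    using integral_gen_size_iterate[of ?a \<mu> t q "r - t"] inv a am q
    by (simp add: q_def M_def)
  also have "(\<lambda>c. ?a c * q ^ gen_size t c) = (\<lambda>c. q ^ gen_size t c - 0 ^ gen_size t c)"
  proof
    show "?a c * q ^ gen_size t c = q ^ gen_size t c - 0 ^ gen_size t c" for c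
      by (cases "gen_size t c") auto
  qed
  also have "(\<integral>c. q ^ gen_size t c - 0 ^ gen_size t c \<partial>M) = q - (gf \<mu> ^^ t) 0"
    using int[OF q] int[of 0] integral_gen_size[OF q, of \<mu> t] integral_gen_size[of 0 \<mu> t]
    by (simp add: M_def q_def)
  finally show ?thesis .
qed

definition visits :: "nat \<Rightarrow> nat \<Rightarrow> (node \<Rightarrow> nat) \<Rightarrow> nat" where
  "visits w T c = card {i. i < T \<and> small_gen w c i}"

lemma visits_eq_sum: "visits w T c = (\<Sum>i<T. of_bool (small_gen w c i))"
proof -
  have "{i. i < T \<and> small_gen w c i} = {..<T} \<inter> {i. small_gen w c i}" by auto
  then show ?thesis by (simp add: visits_def sum_of_bool_eq)
qed

lemma measurable_visits [measurable]:
  "visits w T \<in> measurable (gw_offspring \<mu>) (count_space UNIV)"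
  unfolding visits_eq_sum by measurable

text \<open>
  After time \<open>t\<close>, the times are sorted by their residue modulo \<open>m\<close>.  The horizon \<open>T\<close> for the number of
  steps of each residue class is generous, but independent of the class.
\<close>

lemma visits_le_residue_sum:
  assumes "m \<ge> 1"
  shows "visits w T c \<le> t + (\<Sum>r<m. \<Sum>j<T. of_bool (small_gen w c (t + r + j * m)))"
proof -
  let ?f = "\<lambda>i. of_bool (small_gen w c i) :: nat"
  have "T \<le> T * m" using assms by simp
  then have "T \<le> t + T * m" by linarith
  then have "visits w T c \<le> (\<Sum>i<t + T * m. ?f i)"
    unfolding visits_eq_sum by (intro sum_mono2) auto
  also have "(\<Sum>i<t + k. ?f i) = (\<Sum>i<t. ?f i) + (\<Sum>i<k. ?f (t + i))" for k
    by (induction k) auto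
  also have "(\<Sum>i<t. ?f i) \<le> t" using sum_bounded_above[of "{..<t}" ?f 1] by simp
  also have "(\<Sum>i<T * m. ?f (t + i)) = (\<Sum>j<T. \<Sum>i\<in>{j * m..<j * m + m}. ?f (t + i))"
    by (rule sum.nat_group[symmetric])
  also have "\<dots> = (\<Sum>j<T. \<Sum>r<m. ?f (t + r + j * m))"
  proof (rule sum.cong[OF refl])
    fix j
    show "(\<Sum>i\<in>{j * m..<j * m + m}. ?f (t + i)) = (\<Sum>r<m. ?f (t + r + j * m))"
      by (rule sum.reindex_bij_witness[of _ "\<lambda>r. r + j * m" "\<lambda>i. i - j * m"]) auto
  qed
  also have "\<dots> = (\<Sum>r<m. \<Sum>j<T. ?f (t + r + j * m))" by (rule sum.swap)
  finally show ?thesis by simp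
qed

lemma reward_eq_powr:
  "reward w m r J c = (4/3) powr real (\<Sum>j<J. of_bool (small_gen w c (r + j * m)))"
proof -
  have "reward w m r J c = (\<Prod>j<J. (4/3) ^ (of_bool (small_gen w c (r + j * m)) :: nat))"
    unfolding reward_def by (intro prod.cong) auto
  then show ?thesis by (simp add: powr_realpow flip: power_sum)
qed

text \<open>Jensen's inequality for the exponential function, through its tangent at \<open>b\<close>.\<close>

lemma powr_average_le:
  fixes N :: "'i \<Rightarrow> real"
  assumes "finite A" "1 \<le> \<alpha>" "real (card A) * b \<le> (\<Sum>r\<in>A. N r)"
  shows "real (card A) * \<alpha> powr b \<le> (\<Sum>r\<in>A. \<alpha> powr N r)"
proof -
  have tangent: "\<alpha> powr b * (1 + (N r - b) * ln \<alpha>) \<le> \<alpha> powr N r" for r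
  proof -
    have "\<alpha> powr N r = \<alpha> powr b * \<alpha> powr (N r - b)" by (simp flip: powr_add)
    moreover have "1 + (N r - b) * ln \<alpha> \<le> \<alpha> powr (N r - b)"
      using assms(2) exp_ge_add_one_self[of "(N r - b) * ln \<alpha>"] by (simp add: powr_def)
    ultimately show ?thesis by (simp add: mult_left_mono)
  qed
  have "real (card A) * \<alpha> powr b \<le> \<alpha> powr b * (real (card A) + ((\<Sum>r\<in>A. N r) - real (card A) * b) * ln \<alpha>)"
    using assms by (simp add: distrib_left)
  also have "\<dots> = (\<Sum>r\<in>A. \<alpha> powr b * (1 + (N r - b) * ln \<alpha>))"
    by (simp add: sum.distrib sum_subtractf left_diff_distrib sum_distrib_right flip: sum_distrib_left)
  also have "\<dots> \<le> (\<Sum>r\<in>A. \<alpha> powr N r)" by (intro sum_mono tangent)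
  finally show ?thesis .
qed

text \<open>
  Many small generations in total force the rewards to be large on average over the residue classes.
  Averaging the expected rewards loses no factor \<open>m\<close>, whereas a union bound over the residue
  classes would; such a loss would destroy the summability over the scales \<open>w\<close>.
\<close>

lemma prob_visits_le:
  fixes \<mu> :: "nat pmf"
  defines "q \<equiv> ext_prob \<mu>" and "M \<equiv> gw_offspring \<mu>"
  assumes half: "\<And>z. 1 \<le> z \<Longrightarrow> z \<le> w \<Longrightarrow> q ^ z \<le> 2 * (gf \<mu> ^^ m) 0 ^ z"
    and m: "m \<ge> 1" and t: "real t \<le> a"
  shows "measure M {c. gen_size T c = 0 \<and> a < real (visits w T c)}
    \<le> 2 * (q - (gf \<mu> ^^ t) 0) * (3/4) powr ((a - real t) / real m)"
proof -
  interpret prob_space M unfolding M_def by (rule prob_space_gw_offspring)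
  note [measurable] = measurable_gen_size[of _ \<mu>, folded M_def] measurable_reward[of _ _ _ _ \<mu>, folded M_def]
    measurable_visits[of _ _ \<mu>, folded M_def]
  have sp: "space M = UNIV" by (simp add: M_def)
  let ?E = "{c. gen_size T c = 0 \<and> a < real (visits w T c)}" and ?b = "(a - real t) / real m"
  have E [measurable]: "?E \<in> sets M"
  proof -
    have "{c \<in> space M. gen_size T c = 0 \<and> a < real (visits w T c)} \<in> sets M" by measurable
    then show ?thesis by (simp add: sp)
  qed
  have q: "0 \<le> q" "q \<le> 1" using ext_prob_bounds by (auto simp: q_def)
  let ?F = "\<lambda>r c. (1 - 0 ^ gen_size t c) * reward w m (t + r) T c
    * potential q (gen_size (t + r + T * m) c)"
  have F0: "0 \<le> ?F r c" for r c
    using reward_nonneg potential_nonneg[OF q(1)] by (auto intro!: mult_nonneg_nonneg simp: power_le_one)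
  have Fint: "integrable M (?F r)" for r
    unfolding M_def
  proof (intro integrable_gw_bounded)
    show "?F r \<in> borel_measurable (gw_offspring \<mu>)" unfolding M_def[symmetric] by measurable
    fix c
    have "potential q (gen_size (t + r + T * m) c) \<le> 2"
      using potential_le[OF q(1), of "gen_size (t + r + T * m) c"]
        power_le_one[OF q, of "gen_size (t + r + T * m) c"] by linarith
    then have "?F r c \<le> (1 * (4/3) ^ T) * 2"
      using reward_nonneg reward_le potential_nonneg[OF q(1)]
      by (intro mult_mono) (auto intro!: mult_nonneg_nonneg simp: power_le_one)
    then show "\<bar>?F r c\<bar> \<le> (1 * (4/3) ^ T) * 2" using F0[of c r] by simp
  qed
  have pt: "real m * (4/3) powr ?b * indicator ?E c \<le> (\<Sum>r<m. ?F r c)" for c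
  proof (cases "c \<in> ?E")
    case True
    let ?N = "\<lambda>r. \<Sum>j<T. of_bool (small_gen w c (t + r + j * m)) :: nat"
    have "t < visits w T c" using True t by auto
    have alive: "gen_size t c \<noteq> 0"
    proof
      assume "gen_size t c = 0"
      then have "{i. i < T \<and> small_gen w c i} \<subseteq> {..<t}"
        using gen_size_eq_0_mono[of t _ c] by (auto simp: small_gen_def) (metis not_less not_less_eq_eq zero_less_iff_neq_zero zero_le One_nat_def le_zero_eq)
      then have "visits w T c \<le> card {..<t}" unfolding visits_def by (intro card_mono) auto
      with \<open>t < visits w T c\<close> show False by simp
    qed
    have dead: "gen_size (t + r + T * m) c = 0" for r
    proof (rule gen_size_eq_0_mono[of T])
      have "T \<le> T * m" using m by simp
      then show "T \<le> t + r + T * m" by linarith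
    qed (use True in simp)
    have F: "?F r c = (4/3) powr real (?N r)" for r
      using alive dead by (simp add: potential_def reward_eq_powr)
    have "real m * (4/3) powr ?b \<le> (\<Sum>r<m. (4/3) powr real (?N r))"
    proof -
      have "real (visits w T c) \<le> real (t + (\<Sum>r<m. ?N r))"
        using visits_le_residue_sum[OF m] of_nat_le_iff by blast
      then have "real m * ?b \<le> (\<Sum>r<m. real (?N r))"
        using True m by simp
      then show ?thesis using powr_average_le[of "{..<m}" "4/3" ?b "\<lambda>r. real (?N r)"] by simp
    qed
    then show ?thesis using True by (simp add: F)
  qed (simp add: sum_nonneg F0)
  have "real m * (4/3) powr ?b * measure M ?E = (\<integral>c. real m * (4/3) powr ?b * indicator ?E c \<partial>M)"
    by simp
  also have "\<dots> \<le> (\<integral>c. (\<Sum>r<m. ?F r c) \<partial>M)"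
    by (intro integral_mono pt Bochner_Integration.integrable_sum Fint integrable_mult_right) (simp add: emeasure_eq_measure)
  also have "\<dots> = (\<Sum>r<m. \<integral>c. ?F r c \<partial>M)"
    by (intro Bochner_Integration.integral_sum Fint)
  also have "\<dots> \<le> (\<Sum>r<m. 2 * (q - (gf \<mu> ^^ t) 0))"
    unfolding q_def M_def using half by (intro sum_mono expected_reward_alive_le) (auto simp: q_def)
  finally have "real m * ((4/3) powr ?b * measure M ?E) \<le> real m * (2 * (q - (gf \<mu> ^^ t) 0))" by simp
  then have "(4/3) powr ?b * measure M ?E \<le> 2 * (q - (gf \<mu> ^^ t) 0)" using m by simp
  moreover have "(3/4::real) powr ?b = 1 / (4/3) powr ?b"
    by (simp add: powr_divide)
  ultimately show ?thesis by (simp add: pos_le_divide_eq mult.commute)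
qed

section \<open>Excess of small generations, uniformly over the scales\<close>

text \<open>
  By Bernoulli's inequality: each of the \<open>z \<le> w\<close> individuals survives for \<open>m\<close> generations with conditional
  probability at most \<open>1 / (1 + 2 w)\<close>.
\<close>

lemma half_of_ext_prob_power:
  assumes \<sigma>: "0 < 1 - pmf \<mu> 1" and q: "0 < ext_prob \<mu>"
    and m: "4 * real w / (1 - pmf \<mu> 1) \<le> real m" and z: "z \<le> w"
  shows "ext_prob \<mu> ^ z \<le> 2 * (gf \<mu> ^^ m) 0 ^ z"
proof -
  let ?q = "ext_prob \<mu>" and ?p = "(gf \<mu> ^^ m) 0"
  define \<sigma> where "\<sigma> = 1 - pmf \<mu> 1"
  define u where "u = 1 / (1 + \<sigma> / 2 * real m)"
  have s: "0 < \<sigma>" using \<sigma> by (simp add: \<sigma>_def)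
  have "4 * real w / \<sigma> \<le> real m" using m by (simp only: \<sigma>_def)
  then have "4 * real w \<le> \<sigma> * real m" using s by (simp add: pos_divide_le_eq mult.commute)
  then have "u \<le> 1 / (1 + 2 * real w)"
    unfolding u_def using s by (intro divide_left_mono mult_pos_pos add_pos_nonneg) auto
  then have "real z * u \<le> real w * (1 / (1 + 2 * real w))"
    using z s by (intro mult_mono) (auto simp: u_def)
  also have "\<dots> \<le> 1 / 2" by (simp add: field_simps)
  finally have zu: "real z * u \<le> 1 / 2" .
  have "1 \<le> 1 + \<sigma> / 2 * real m" using s by simp
  then have u1: "0 \<le> u" "u \<le> 1" unfolding u_def by (auto simp only: divide_le_eq_1_pos zero_le_divide_iff)
  have "1 + real z * (- u) \<le> (1 + (- u)) ^ z"
    using u1 by (intro Bernoulli_inequality) auto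
  then have "1 / 2 \<le> (1 - u) ^ z" using zu by simp
  then have "?q ^ z * (1 / 2) \<le> ?q ^ z * (1 - u) ^ z"
    using q by (intro mult_left_mono) auto
  also have "\<dots> = (?q * (1 - u)) ^ z" by (simp add: power_mult_distrib)
  also have "\<dots> \<le> ?p ^ z"
  proof (rule power_mono)
    show "?q * (1 - u) \<le> ?p"
      using gf_iterate_0_bound[OF q, of m] by (simp add: u_def \<sigma>_def algebra_simps)
  qed (use q u1 in auto)
  finally show ?thesis by simp
qed

lemma prob_gen_size_eq_0: "measure (gw_offspring \<mu>) {c. gen_size n c = 0} = (gf \<mu> ^^ n) 0"
proof -
  interpret prob_space "gw_offspring \<mu>" by (rule prob_space_gw_offspring)
  have "(\<integral>c. 0 ^ gen_size n c \<partial>gw_offspring \<mu>) = (\<integral>c. indicator {c. gen_size n c = 0} c \<partial>gw_offspring \<mu> :: real)"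
    by (intro Bochner_Integration.integral_cong) (auto simp: power_0_left split: split_indicator)
  also have "\<dots> = measure (gw_offspring \<mu>) {c. gen_size n c = 0}" by simp
  finally show ?thesis using integral_gen_size[of 0 \<mu> n] by simp
qed

lemma three_quarters_powr_le: "0 \<le> x \<Longrightarrow> (3/4 :: real) powr (4 * x) \<le> exp (- x)"
proof -
  assume x: "0 \<le> x"
  have "exp (1::real) \<le> (4/3) ^ 4" using exp_le by (simp add: power_divide)
  then have "1 \<le> 4 * ln (4/3 :: real)"
    by (metis exp_gt_zero ln_exp ln_mono ln_realpow of_nat_numeral zero_less_divide_iff zero_less_numeral)
  then have "x * 1 \<le> x * (4 * ln (4/3 :: real))" using x by (intro mult_left_mono) auto
  moreover have "ln (3/4 :: real) = - ln (4/3)" by (simp add: ln_div)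
  ultimately show ?thesis by (simp add: powr_def)
qed

text \<open>
  The constant 40 serves two purposes: with \<open>m \<le> 5 w / \<sigma>\<close>, half of \<open>40 x w / \<sigma>\<close> is at least \<open>4 x m\<close>, where
  \<open>(3/4) ^ (4 x) \<le> exp (- x)\<close>; and it leaves a prefactor small enough for the sum over
  dyadic \<open>w\<close> to be at most 1.
\<close>

definition thin :: "nat pmf \<Rightarrow> real \<Rightarrow> nat \<Rightarrow> nat \<Rightarrow> (node \<Rightarrow> nat) set" where
  "thin \<mu> x w T = {c. gen_size T c = 0 \<and> 40 * x * real w / (1 - pmf \<mu> 1) < real (visits w T c)}"

lemma thin_in_sets [measurable]: "thin \<mu> x w T \<in> sets (gw_offspring \<mu>)"
proof -
  have "{c \<in> space (gw_offspring \<mu>). gen_size T c = 0 \<and> 40 * x * real w / (1 - pmf \<mu> 1) < real (visits w T c)}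
    \<in> sets (gw_offspring \<mu>)"
    by measurable
  then show ?thesis by (simp add: thin_def)
qed

text \<open>
  Half of the allotted time is used for the survival probability, which yields the factor \<open>1 / w\<close>, and the
  other half for the geometric tail.
\<close>

lemma prob_thin_le:
  assumes \<sigma>: "0 < 1 - pmf \<mu> 1" and x: "1 \<le> x" and w: "1 \<le> w"
  shows "measure (gw_offspring \<mu>) (thin \<mu> x w T) \<le> exp (- x) / (5 * real w)"
proof (cases "ext_prob \<mu> = 0")
  case True
  interpret prob_space "gw_offspring \<mu>" by (rule prob_space_gw_offspring)
  have "{c \<in> space (gw_offspring \<mu>). gen_size T c = 0} \<in> sets (gw_offspring \<mu>)" by measurable
  then have "measure (gw_offspring \<mu>) (thin \<mu> x w T) \<le> measure (gw_offspring \<mu>) {c. gen_size T c = 0}"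
    by (intro finite_measure_mono) (auto simp: thin_def)
  also have "\<dots> \<le> 0"
    using gf_iterate_0_le_ext_prob[of T \<mu>] True by (simp add: prob_gen_size_eq_0)
  also have "0 \<le> exp (- x) / (5 * real w)" by simp
  finally show ?thesis .
next
  case False
  then have q: "0 < ext_prob \<mu>" "ext_prob \<mu> \<le> 1" using ext_prob_bounds[of \<mu>] by auto
  define \<sigma> where "\<sigma> = 1 - pmf \<mu> 1"
  define a where "a = 40 * x * real w / \<sigma>"
  define m where "m = nat \<lceil>4 * real w / \<sigma>\<rceil>"
  \<comment> \<open>\<open>m\<close> is the time in which \<open>w\<close> individuals probably die out, and \<open>t\<close> is half of the allotted time.\<close>
  define t where "t = nat \<lfloor>a / 2\<rfloor>"
  have s: "0 < \<sigma>" "\<sigma> \<le> 1" using \<sigma> by (auto simp: \<sigma>_def)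
  have xw: "1 \<le> x * real w" using mult_mono[of 1 x 1 "real w"] x w by simp
  have w\<sigma>: "1 \<le> real w / \<sigma>" using s w by (simp add: pos_le_divide_eq)
  have m_lower: "4 * real w / \<sigma> \<le> real m" unfolding m_def by linarith
  have "real m \<le> 4 * real w / \<sigma> + 1" using s by (simp add: m_def)
  also have "\<dots> \<le> 5 * (real w / \<sigma>)" using w\<sigma> by simp
  finally have m_upper: "real m \<le> 5 * (real w / \<sigma>)" .
  have m1: "1 \<le> m" using m_lower w\<sigma> by (cases m) auto
  have a0: "0 \<le> a" using s x by (simp add: a_def)
  have t: "a / 2 - 1 \<le> real t" "real t \<le> a / 2" using a0 unfolding t_def by linarith+
  have "\<sigma> * a = 40 * (x * real w)" using s by (simp add: a_def)
  moreover have "\<sigma> * (a / 2 - 1) \<le> \<sigma> * real t" using t s by (intro mult_left_mono) auto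
  ultimately have "20 * (x * real w) - 1 \<le> \<sigma> * real t" using s by (simp add: algebra_simps)
  moreover have "real w \<le> x * real w" using x by (simp add: mult_le_cancel_right1)
  ultimately have t': "10 * real w \<le> 1 + \<sigma> / 2 * real t" using xw by simp
  have "ext_prob \<mu> - (gf \<mu> ^^ t) 0 \<le> ext_prob \<mu> / (1 + \<sigma> / 2 * real t)"
    using gf_iterate_0_bound[OF q(1), of t] by (simp add: \<sigma>_def)
  also have "\<dots> \<le> 1 / (10 * real w)" using t' q w by (intro frac_le) auto
  finally have surv: "2 * (ext_prob \<mu> - (gf \<mu> ^^ t) 0) \<le> 1 / (5 * real w)" by simp
  have "4 * x * real m \<le> 4 * x * (5 * (real w / \<sigma>))"
    using m_upper x by (intro mult_left_mono) auto
  also have "\<dots> = a / 2" by (simp add: a_def)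
  also have "\<dots> \<le> a - real t" using t by simp
  finally have "4 * x \<le> (a - real t) / real m" using m1 by (simp add: pos_le_divide_eq)
  then have "(3/4 :: real) powr ((a - real t) / real m) \<le> (3/4) powr (4 * x)"
    by (intro powr_mono') auto
  also have "\<dots> \<le> exp (- x)" using x by (intro three_quarters_powr_le) auto
  finally have decay: "(3/4 :: real) powr ((a - real t) / real m) \<le> exp (- x)" .
  have "measure (gw_offspring \<mu>) (thin \<mu> x w T)
      \<le> 2 * (ext_prob \<mu> - (gf \<mu> ^^ t) 0) * (3/4) powr ((a - real t) / real m)"
    unfolding thin_def \<sigma>_def[symmetric] a_def[symmetric]
    using half_of_ext_prob_power[OF \<sigma> q(1), of w m] m_lower m1 t a0
    by (intro prob_visits_le) (auto simp: \<sigma>_def)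
  also have "\<dots> \<le> 1 / (5 * real w) * exp (- x)"
    using surv decay gf_iterate_0_le_ext_prob[of t \<mu>] by (intro mult_mono) auto
  finally show ?thesis by simp
qed

lemma thin_mono: "T \<le> T' \<Longrightarrow> thin \<mu> x w T \<subseteq> thin \<mu> x w T'"
proof
  fix c assume T: "T \<le> T'" and c: "c \<in> thin \<mu> x w T"
  have "visits w T c \<le> visits w T' c"
    unfolding visits_def using T by (intro card_mono) auto
  then show "c \<in> thin \<mu> x w T'"
    using c gen_size_eq_0_mono[OF T, of c] by (simp add: thin_def)
qed

text \<open>
  The union over \<open>T\<close> is increasing and drops the horizon; over \<open>k\<close>, the bounds form a geometric series.
\<close>

lemma prob_thin_at_some_scale_le:
  assumes \<sigma>: "0 < 1 - pmf \<mu> 1" and x: "1 \<le> x"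
  shows "measure (gw_offspring \<mu>) (\<Union>k. \<Union>T. thin \<mu> x (2 ^ k) T) \<le> exp (- x)"
proof -
  interpret prob_space "gw_offspring \<mu>" by (rule prob_space_gw_offspring)
  let ?A = "\<lambda>k. \<Union>T. thin \<mu> x (2 ^ k) T"
  have scale: "prob (?A k) \<le> exp (- x) / 5 * (1 / 2) ^ k" for k
  proof -
    have "(\<lambda>T. prob (thin \<mu> x (2 ^ k) T)) \<longlonglongrightarrow> prob (?A k)"
      by (intro finite_Lim_measure_incseq) (auto intro!: monoI thin_mono)
    moreover have "prob (thin \<mu> x (2 ^ k) T) \<le> exp (- x) / 5 * (1 / 2) ^ k" for T
      using prob_thin_le[OF \<sigma> x, of "2 ^ k" T] by (simp add: power_divide)
    ultimately show ?thesis by (intro LIMSEQ_le_const2[of _ "prob (?A k)"]) auto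
  qed
  have geo: "summable (\<lambda>k. exp (- x) / 5 * (1 / 2 :: real) ^ k)"
    by (intro summable_mult summable_geometric) simp
  have sm: "summable (\<lambda>k. prob (?A k))"
    by (rule summable_comparison_test'[OF geo]) (use scale in auto)
  have "prob (\<Union>k. ?A k) \<le> (\<Sum>k. prob (?A k))"
    by (rule finite_measure_subadditive_countably) (use sm in auto)
  also have "\<dots> \<le> (\<Sum>k. exp (- x) / 5 * (1 / 2) ^ k)"
    by (intro suminf_le scale sm geo)
  also have "\<dots> = exp (- x) / 5 * 2"
    by (subst suminf_mult) (auto simp: suminf_geometric)
  also have "\<dots> \<le> exp (- x)" by simp
  finally show ?thesis .
qed

section \<open>Infinite trees of finite width\<close>

text \<open>
  On a generation size \<open>z\<close> in \<open>[1, w]\<close> the function \<open>s ^ z - 0 ^ z\<close> is at least \<open>s ^ w\<close>, and it is nonnegative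
  for all \<open>z\<close>.
\<close>

lemma prob_small_gen_le:
  assumes s: "0 \<le> s" "s \<le> 1"
  shows "s ^ w * measure (gw_offspring \<mu>) {c. small_gen w c n} \<le> (gf \<mu> ^^ n) s - (gf \<mu> ^^ n) 0"
proof -
  let ?M = "gw_offspring \<mu>"
  interpret prob_space ?M by (rule prob_space_gw_offspring)
  have [measurable]: "{c. small_gen w c n} \<in> sets ?M"
  proof -
    have "{c \<in> space ?M. small_gen w c n} \<in> sets ?M" by measurable
    then show ?thesis by simp
  qed
  have int: "integrable ?M (\<lambda>c. r ^ gen_size n c)" if "0 \<le> r" "r \<le> 1" for r :: real
    using that by (intro integrable_gw_bounded[where B = 1]) (auto simp: power_le_one)
  have "s ^ w * prob {c. small_gen w c n} = (\<integral>c. s ^ w * indicator {c. small_gen w c n} c \<partial>?M)"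
    by simp
  also have "\<dots> \<le> (\<integral>c. s ^ gen_size n c - 0 ^ gen_size n c \<partial>?M)"
  proof (rule integral_mono)
    fix c
    show "s ^ w * indicator {c. small_gen w c n} c \<le> s ^ gen_size n c - 0 ^ gen_size n c"
    proof (cases "gen_size n c = 0")
      case False
      then show ?thesis
        using s by (auto simp: small_gen_def indicator_def power_0_left intro: power_decreasing)
    qed (simp add: small_gen_def)
  qed (use int[OF s] int[of 0] in \<open>auto simp: emeasure_eq_measure\<close>)
  also have "\<dots> = (gf \<mu> ^^ n) s - (gf \<mu> ^^ n) 0"
    using int[OF s] int[of 0] integral_gen_size[OF s, of \<mu> n] integral_gen_size[of 0 \<mu> n] by simp
  finally show ?thesis .
qed

definition forever_small :: "nat \<Rightarrow> (node \<Rightarrow> nat) set" where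
  "forever_small w = {c. \<forall>n. small_gen w c n}"

lemma forever_small_null:
  assumes \<sigma>: "0 < 1 - pmf \<mu> 1"
  shows "forever_small w \<in> null_sets (gw_offspring \<mu>)"
proof -
  let ?M = "gw_offspring \<mu>"
  interpret prob_space ?M by (rule prob_space_gw_offspring)
  have "{c \<in> space ?M. small_gen w c n} \<in> sets ?M" for n by measurable
  then have small: "{c. small_gen w c n} \<in> sets ?M" for n by simp
  have "{c \<in> space ?M. \<forall>n. small_gen w c n} \<in> sets ?M" by measurable
  then have sets: "forever_small w \<in> sets ?M" by (simp add: forever_small_def)
  obtain s where s: "0 < s" "s \<le> 1" and lim: "(\<lambda>n. (gf \<mu> ^^ n) s - (gf \<mu> ^^ n) 0) \<longlonglongrightarrow> 0"
    using gf_iterates_merge[OF \<sigma>] .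
  have "s ^ w * prob (forever_small w) \<le> (gf \<mu> ^^ n) s - (gf \<mu> ^^ n) 0" for n
  proof -
    have "s ^ w * prob (forever_small w) \<le> s ^ w * prob {c. small_gen w c n}"
      using s small by (intro mult_left_mono finite_measure_mono) (auto simp: forever_small_def)
    also have "\<dots> \<le> (gf \<mu> ^^ n) s - (gf \<mu> ^^ n) 0"
      using s by (intro prob_small_gen_le) auto
    finally show ?thesis .
  qed
  then have "s ^ w * prob (forever_small w) \<le> 0"
    by (intro LIMSEQ_le_const[OF lim]) auto
  moreover have "0 < s ^ w" using s by simp
  ultimately have "prob (forever_small w) \<le> 0" by (simp add: mult_le_0_iff)
  then have "prob (forever_small w) = 0" using measure_nonneg[of ?M "forever_small w"] by linarith
  with sets show ?thesis by (simp add: null_sets_def emeasure_eq_measure)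
qed

section \<open>Tall trees have too many small generations\<close>

lemma dyadic_upper_approx:
  fixes y :: real
  assumes "1 \<le> y"
  obtains k :: nat where "y \<le> 2 ^ k" "2 ^ k < 2 * y"
proof -
  define k where "k = (LEAST k. y \<le> 2 ^ k)"
  have "\<exists>k. y \<le> 2 ^ k" using real_arch_pow[of 2 y] by (auto intro: less_imp_le)
  then have "y \<le> 2 ^ k" unfolding k_def by (rule LeastI_ex)
  moreover have "2 ^ k < 2 * y"
  proof (cases k)
    case (Suc j)
    then have "\<not> y \<le> 2 ^ j" using not_less_Least[of j "\<lambda>k. y \<le> 2 ^ k"] by (simp add: k_def)
    then show ?thesis by (simp add: Suc)
  qed (use assms in simp)
  ultimately show thesis by (rule that)
qed

lemma ht_finite:
  assumes "gen_size T c = 0"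
  obtains h where "ht (tree_of c) = enat h" "\<And>n. n \<le> h \<Longrightarrow> gen_size n c \<noteq> 0" "gen_size (Suc h) c = 0"
proof -
  define l where "l = (LEAST n. gen_size n c = 0)"
  have l0: "gen_size l c = 0" unfolding l_def using assms by (rule LeastI)
  have lt: "gen_size n c \<noteq> 0" if "n < l" for n
    using not_less_Least[of n "\<lambda>n. gen_size n c = 0"] that by (auto simp: l_def)
  obtain h where h: "l = Suc h" using l0 by (cases l) auto
  have nz: "0 < gen_size n c \<longleftrightarrow> n \<le> h" for n
  proof (cases "n \<le> h")
    case True
    then show ?thesis using lt[of n] by (simp add: h)
  next
    case False
    then show ?thesis using gen_size_eq_0_mono[of l n c] l0 by (simp add: h)
  qed
  have "{enat n | n. ecard (level (tree_of c) n) \<noteq> 0} = enat ` {..h}"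
    using nz by (auto simp: ecard_level zero_enat_def)
  moreover have "Sup (enat ` {..h}) = enat h"
    by (intro antisym Sup_least Sup_upper) auto
  ultimately have "ht (tree_of c) = enat h" by (simp add: ht_def)
  with l0 nz show thesis by (intro that[of h]) (auto simp: h)
qed

lemma sum_gen_size_le_card:
  assumes "finite (tree_of c)"
  shows "(\<Sum>n<N. gen_size n c) \<le> card (tree_of c)"
proof -
  have "(\<Sum>n<N. gen_size n c) = card (\<Union>n<N. level (tree_of c) n)"
    unfolding gen_size_def
    by (rule card_UN_disjoint[symmetric]) (auto simp: finite_level_tree_of, auto simp: level_def)
  also have "\<dots> \<le> card (tree_of c)"
    using assms by (intro card_mono) (auto simp: level_def)
  finally show ?thesis .
qed

lemma gen_size_le_wid: "enat (gen_size n c) \<le> wid (tree_of c)"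
  unfolding wid_def using SUP_upper[of n UNIV "\<lambda>n. ecard (level (tree_of c) n)"] by (simp add: ecard_level)

text \<open>
  All generations have size at most \<open>W = wid(T)\<close>; rounding \<open>W\<close> up to a power of two at most doubles it,
  which turns the constant 80 into 40.
\<close>

lemma tall_for_width_imp_thin:
  assumes \<sigma>: "0 < 1 - pmf \<mu> 1" and x: "1 \<le> x"
    and tall: "ennreal_of_enat (ht (tree_of c))
      > ennreal (80 * x) * (ennreal_of_enat (wid (tree_of c)) / ennreal (1 - pmf \<mu> 1))"
  shows "c \<in> (\<Union>k. \<Union>T. thin \<mu> x (2 ^ k) T) \<union> (\<Union>w. forever_small w)"
proof -
  define \<sigma> where "\<sigma> = 1 - pmf \<mu> 1"
  have s: "0 < \<sigma>" using \<sigma> by (simp add: \<sigma>_def)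
  have "wid (tree_of c) \<noteq> \<infinity>"
  proof
    assume "wid (tree_of c) = \<infinity>"
    then show False using tall \<sigma> x by (simp add: ennreal_top_divide ennreal_mult_top)
  qed
  then obtain W where W: "wid (tree_of c) = enat W" by auto
  have le_W: "gen_size n c \<le> W" for n using gen_size_le_wid[of n c] by (simp add: W)
  have W1: "1 \<le> W" using le_W[of 0] by simp
  show ?thesis
  proof (cases "\<exists>T. gen_size T c = 0")
    case False
    then have "c \<in> forever_small W" using le_W by (auto simp: forever_small_def small_gen_def Suc_le_eq)
    then show ?thesis by blast
  next
    case True
    then obtain h where h: "ht (tree_of c) = enat h" "\<And>n. n \<le> h \<Longrightarrow> gen_size n c \<noteq> 0"
      "gen_size (Suc h) c = 0" using ht_finite by blast
    have "ennreal (80 * x) * (ennreal_of_enat (wid (tree_of c)) / ennreal \<sigma>) = ennreal (80 * x * (real W / \<sigma>))"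
      using s x by (simp add: W ennreal_of_nat_eq_real_of_nat divide_ennreal ennreal_mult[symmetric])
    then have tall': "80 * x * (real W / \<sigma>) < real h"
      using tall s x unfolding \<sigma>_def[symmetric] h(1)
      by (simp add: ennreal_of_nat_eq_real_of_nat ennreal_less_iff)
    obtain k where k: "real W \<le> 2 ^ k" "2 ^ k < 2 * real W"
      using dyadic_upper_approx[of "real W"] W1 by auto
    have "W \<le> 2 ^ k" using k(1) by (simp flip: of_nat_le_iff)
    then have "{i. i < Suc h \<and> small_gen (2 ^ k) c i} = {..<Suc h}"
      using h(2) le_W by (auto simp: small_gen_def Suc_le_eq less_Suc_eq_le intro: order_trans)
    then have "visits (2 ^ k) (Suc h) c = Suc h" by (simp add: visits_def)
    moreover have "40 * x * 2 ^ k / \<sigma> \<le> 80 * x * (real W / \<sigma>)"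
    proof -
      have "(40 * x / \<sigma>) * 2 ^ k \<le> (40 * x / \<sigma>) * (2 * real W)"
        using k s x by (intro mult_left_mono) auto
      then show ?thesis by simp
    qed
    ultimately have "c \<in> thin \<mu> x (2 ^ k) (Suc h)"
      using tall' h(3) unfolding thin_def mem_Collect_eq \<sigma>_def[symmetric] by simp
    then show ?thesis by blast
  qed
qed

text \<open>
  With \<open>N = |T|\<close> and \<open>h = ht(T)\<close>, at most \<open>h / 2\<close> generations are larger than \<open>2 N / h\<close>, twice the
  mean size.  The scale is \<open>2 N / h\<close> rounded up to a power of two, and the constant 80 suffices
  since \<open>80\<^sup>2 \<ge> 8 * 40\<close>.
\<close>

lemma tall_for_size_imp_thin:
  assumes \<sigma>: "0 < 1 - pmf \<mu> 1" and x: "1 \<le> x"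
    and tall: "ennreal_of_enat (ht (tree_of c))
      > ennreal (80 * x) * ennreal_sqrt (ennreal_of_enat (ecard (tree_of c)) / ennreal (1 - pmf \<mu> 1))"
  shows "c \<in> (\<Union>k. \<Union>T. thin \<mu> (x\<^sup>2) (2 ^ k) T)"
proof -
  define \<sigma> where "\<sigma> = 1 - pmf \<mu> 1"
  have s: "0 < \<sigma>" using \<sigma> by (simp add: \<sigma>_def)
  have fin: "finite (tree_of c)"
  proof (rule ccontr)
    assume "infinite (tree_of c)"
    then show False using tall \<sigma> x
      by (simp add: ecard_def ennreal_sqrt_def ennreal_top_divide ennreal_mult_top)
  qed
  define N where "N = card (tree_of c)"
  have "\<exists>T. gen_size T c = 0"
  proof (rule ccontr)
    assume "\<not> (\<exists>T. gen_size T c = 0)"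
    then have "(\<Sum>n<Suc N. 1) \<le> (\<Sum>n<Suc N. gen_size n c)"
      by (intro sum_mono) (auto simp: Suc_le_eq)
    then show False using sum_gen_size_le_card[OF fin, of "Suc N"] by (simp add: N_def)
  qed
  then obtain h where h: "ht (tree_of c) = enat h" "\<And>n. n \<le> h \<Longrightarrow> gen_size n c \<noteq> 0"
    "gen_size (Suc h) c = 0" using ht_finite by blast
  have N_sum: "(\<Sum>n<Suc h. gen_size n c) \<le> N"
    unfolding N_def by (rule sum_gen_size_le_card[OF fin])
  have "(\<Sum>n<Suc h. 1) \<le> (\<Sum>n<Suc h. gen_size n c)"
    using h(2) by (intro sum_mono) (auto simp: Suc_le_eq less_Suc_eq_le)
  with N_sum have hN: "Suc h \<le> N" by simp
  have "ennreal (80 * x) * ennreal_sqrt (ennreal_of_enat (ecard (tree_of c)) / ennreal \<sigma>)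
      = ennreal (80 * x * sqrt (real N / \<sigma>))"
    using s x by (simp add: ecard_def fin N_def[symmetric] ennreal_sqrt_def ennreal_of_nat_eq_real_of_nat
        divide_ennreal ennreal_mult[symmetric])
  then have tall': "80 * x * sqrt (real N / \<sigma>) < real h"
    using tall s x unfolding \<sigma>_def[symmetric] h(1)
    by (simp add: ennreal_of_nat_eq_real_of_nat ennreal_less_iff)
  have "0 \<le> 80 * x * sqrt (real N / \<sigma>)" using s x by simp
  with tall' have h0: "0 < real h" by linarith
  have "(80 * x * sqrt (real N / \<sigma>))\<^sup>2 < (real h)\<^sup>2"
    using tall' \<open>0 \<le> 80 * x * sqrt (real N / \<sigma>)\<close> by (intro power_strict_mono) auto
  then have sq: "6400 * x\<^sup>2 * (real N / \<sigma>) < (real h)\<^sup>2"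
    using s by (simp add: power_mult_distrib)
  define y where "y = 2 * real N / real h"
  have "2 \<le> y" using hN h0 by (simp add: y_def pos_le_divide_eq)
  then obtain k where k: "y \<le> 2 ^ k" "2 ^ k < 2 * y" using dyadic_upper_approx[of y] by auto
  have "real (Suc h) = (\<Sum>n<Suc h. 1)" by simp
  \<comment> \<open>A generation that is not small contains more than \<open>2 ^ k\<close> nodes.\<close>
  also have "\<dots> \<le> (\<Sum>n<Suc h. of_bool (small_gen (2 ^ k) c n) + real (gen_size n c) / 2 ^ k)"
  proof (rule sum_mono)
    fix n assume "n \<in> {..<Suc h}"
    then have "1 \<le> gen_size n c" using h(2)[of n] by simp
    moreover have "1 \<le> real (gen_size n c) / 2 ^ k" if "2 ^ k < gen_size n c"
      using that by (simp add: pos_le_divide_eq)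
    ultimately show "1 \<le> of_bool (small_gen (2 ^ k) c n) + real (gen_size n c) / 2 ^ k"
      by (cases "small_gen (2 ^ k) c n") (auto simp: small_gen_def)
  qed
  also have "\<dots> = real (visits (2 ^ k) (Suc h) c) + real (\<Sum>n<Suc h. gen_size n c) / 2 ^ k"
    by (simp only: sum.distrib visits_eq_sum of_nat_sum sum_divide_distrib of_nat_of_bool)
  also have "\<dots> \<le> real (visits (2 ^ k) (Suc h) c) + real N / y"
  proof -
    have "real (\<Sum>n<Suc h. gen_size n c) / 2 ^ k \<le> real N / y"
      using N_sum k(1) \<open>2 \<le> y\<close> by (intro frac_le) (auto simp del: sum.lessThan_Suc of_nat_sum)
    then show ?thesis by simp
  qed
  also have "real N / y = real h / 2" using hN by (simp add: y_def)
  finally have visits: "real h / 2 < real (visits (2 ^ k) (Suc h) c)" by simp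
  have "40 * x\<^sup>2 * 2 ^ k / \<sigma> = (40 * x\<^sup>2 / \<sigma>) * 2 ^ k" by simp
  also have "\<dots> \<le> (40 * x\<^sup>2 / \<sigma>) * (2 * y)" using k s by (intro mult_left_mono) auto
  also have "\<dots> = 6400 * x\<^sup>2 * (real N / \<sigma>) / (40 * real h)" by (simp add: y_def)
  also have "\<dots> \<le> (real h)\<^sup>2 / (40 * real h)" using sq h0 by (intro divide_right_mono) auto
  also have "\<dots> \<le> real h / 2" using h0 by (simp add: power2_eq_square)
  finally have "c \<in> thin \<mu> (x\<^sup>2) (2 ^ k) (Suc h)"
    using visits h(3) unfolding thin_def mem_Collect_eq \<sigma>_def[symmetric] by simp
  then show ?thesis by blast
qed

text \<open>Both bounds are infinite because of \<open>a / 0 = \<infinity>\<close> for \<open>a > 0\<close>.\<close>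

lemma not_tall_if_no_branching:
  assumes "pmf \<mu> 1 = 1" "0 < a"
  shows "\<not> ennreal_of_enat (ht (tree_of c))
      > ennreal a * (ennreal_of_enat (wid (tree_of c)) / ennreal (1 - pmf \<mu> 1))"
    and "\<not> ennreal_of_enat (ht (tree_of c))
      > ennreal a * ennreal_sqrt (ennreal_of_enat (ecard (tree_of c)) / ennreal (1 - pmf \<mu> 1))"
proof -
  have "wid (tree_of c) \<noteq> 0"
    using gen_size_le_wid[of 0 c] by (auto simp: zero_enat_def)
  then have "ennreal_of_enat (wid (tree_of c)) \<noteq> 0"
    using ennreal_of_enat_inj[of _ 0] by simp
  then show "\<not> ennreal_of_enat (ht (tree_of c))
      > ennreal a * (ennreal_of_enat (wid (tree_of c)) / ennreal (1 - pmf \<mu> 1))"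
    using assms by (simp add: ennreal_divide_zero ennreal_mult_top)
  have "ecard (tree_of c) \<noteq> 0"
    using tree_of.root[of c] by (auto simp: ecard_def zero_enat_def)
  then have "ennreal_of_enat (ecard (tree_of c)) \<noteq> 0"
    using ennreal_of_enat_inj[of _ 0] by simp
  then show "\<not> ennreal_of_enat (ht (tree_of c))
      > ennreal a * ennreal_sqrt (ennreal_of_enat (ecard (tree_of c)) / ennreal (1 - pmf \<mu> 1))"
    using assms by (simp add: ennreal_divide_zero ennreal_mult_top ennreal_sqrt_def)
qed

theorem theorem1p1:
  shows "\<exists>C::real. C > 0 \<and> (\<forall>(\<mu> :: nat pmf) (x :: real). x \<ge> 1 \<longrightarrow>
    \<P>(c in gw_offspring \<mu>.
       ennreal_of_enat (ht (tree_of c))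
         > ennreal (C * x) * (ennreal_of_enat (wid (tree_of c)) / ennreal (1 - pmf \<mu> 1)))
      \<le> exp (- x) \<and>
    \<P>(c in gw_offspring \<mu>.
       ennreal_of_enat (ht (tree_of c))
         > ennreal (C * x) * ennreal_sqrt (ennreal_of_enat (ecard (tree_of c)) / ennreal (1 - pmf \<mu> 1)))
      \<le> exp (- (x\<^sup>2)))"
proof (intro exI[of _ 80] conjI allI impI)
  fix \<mu> :: "nat pmf" and x :: real assume x: "1 \<le> x"
  let ?M = "gw_offspring \<mu>"
  let ?E1 = "{c \<in> space ?M. ennreal_of_enat (ht (tree_of c))
         > ennreal (80 * x) * (ennreal_of_enat (wid (tree_of c)) / ennreal (1 - pmf \<mu> 1))}"
  let ?E2 = "{c \<in> space ?M. ennreal_of_enat (ht (tree_of c))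
         > ennreal (80 * x) * ennreal_sqrt (ennreal_of_enat (ecard (tree_of c)) / ennreal (1 - pmf \<mu> 1))}"
  interpret prob_space ?M by (rule prob_space_gw_offspring)
  have "measure ?M ?E1 \<le> exp (- x) \<and> measure ?M ?E2 \<le> exp (- (x\<^sup>2))"
  proof (cases "pmf \<mu> 1 = 1")
    case True
    have "?E1 = {}" "?E2 = {}" using not_tall_if_no_branching[OF True, of "80 * x"] x by auto
    then show ?thesis by simp
  next
    case False
    then have \<sigma>: "0 < 1 - pmf \<mu> 1" using pmf_le_1[of \<mu> 1] by linarith
    let ?B = "\<lambda>x. \<Union>k. \<Union>T. thin \<mu> x (2 ^ k) T" and ?N = "\<Union>w. forever_small w"
    have N: "?N \<in> null_sets ?M" using forever_small_null[OF \<sigma>] by (intro null_sets_UN) auto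
    have B: "?B y \<in> sets ?M" for y by measurable
    have "measure ?M ?E1 \<le> measure ?M (?B x \<union> ?N)"
      using B N by (intro finite_measure_mono subsetI tall_for_width_imp_thin[OF \<sigma> x]) (auto dest: null_setsD2)
    also have "\<dots> = measure ?M (?B x)" using B N by (rule measure_Un_null_set)
    also have "\<dots> \<le> exp (- x)" by (rule prob_thin_at_some_scale_le[OF \<sigma> x])
    finally have 1: "measure ?M ?E1 \<le> exp (- x)" .
    have "measure ?M ?E2 \<le> measure ?M (?B (x\<^sup>2))"
      using B by (intro finite_measure_mono subsetI tall_for_size_imp_thin[OF \<sigma> x]) auto
    also have "\<dots> \<le> exp (- (x\<^sup>2))" using x by (intro prob_thin_at_some_scale_le[OF \<sigma>]) simp
    finally show ?thesis using 1 by simp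
  qed
  then show "measure ?M ?E1 \<le> exp (- x)" "measure ?M ?E2 \<le> exp (- (x\<^sup>2))" by simp_all
qed simp

end
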